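(* \textsc{Changing Cost Temporal Orienteering} is solvable in $O((nTk)^2)$ time for any instance $((G,F),s,s,k,f)$ in which $G$ is a tree with $n$ vertices, the source and the sink are the same vertex $s$, the lifetime of $(G,F)$ is $T$, and the maximum traversal number of every edge in $(G,F)$ is at most $3$.
   Context: A temporal cost graph is a pair $(G,F)$ where $G=(V,E)$ is a static graph and $F:V\times V\times[T]\times[T]\to\mathbb{N}_0\cup\{\infty\}$ ($F(v_1,v_2,t_1,t_2)$ is the cost of departing $v_1$ at time $t_1$ and arriving at $v_2$ at time $t_2$), with $F(v_1,v_2,t_1,t_2)=\infty$ whenever $t_1\ge t_2$, $F(v,v,t_1,t_2)=0$ for all $v$ and $t_1<t_2$, and $F(v_1,v_2,t_1,t_2)>0$ whenever $v_1\ne v_2$; values of $F$ can be looked up in constant time. The lifetime $T$ is the latest time $t'$ such that $F(v,u,t,t')<\infty$ for some $v,u,t$. A valid walk is a sequence $(u_1,v_1,t_1,t_1'),\dots,(u_\ell,v_\ell,t_\ell,t_\ell')$ with $v_i=u_{i+1}$ and $t_i'\le t_{i+1}$ for $i<\ell$, and $t_i<t_i'$, $F(u_i,v_i,t_i,t_i')<\infty$ for all $i$; its cost is $\sum_iF(u_i,v_i,t_i,t_i')$. The maximum traversal number of an edge $uv$ of $G$ is the largest $j$ for which there is a sequence of time pairs $(t_1,t_1'),\dots,(t_j,t_j')$ with $\min\{F(u,v,t_i,t_i'),F(v,u,t_i,t_i')\}<\infty$ for each $i$ and $t_i'\le t_{i+1}$ for each $i\le j-1$. \textsc{Changing Cost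 Temporal Orienteering} (CCTO), on instance $((G,F),v_s,v_t,k,f)$: decide whether there is a valid walk from source $v_s$ to sink $v_t$ visiting at least $k$ distinct vertices (source and sink counted) with cost at most the budget $f$. *)

theory Defs
  imports "HOL-Library.Extended_Nat"
begin

section \<open>Trees\<close>

definition simple_graph :: "'v set \<Rightarrow> 'v set set \<Rightarrow> bool" where
  "simple_graph V E \<longleftrightarrow>
     finite V \<and> (\<forall>e\<in>E. \<exists>u\<in>V. \<exists>v\<in>V. u \<noteq> v \<and> e = {u, v})"

definition connected_graph :: "'v set \<Rightarrow> 'v set set \<Rightarrow> bool" where
  "connected_graph V E \<longleftrightarrow>
     V \<noteq> {} \<and>
     (\<forall>u\<in>V. \<forall>v\<in>V. \<exists>xs. xs \<noteq> [] \<and> hd xs = u \<and> last xs = v \<and>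
        successively (\<lambda>x y. {x, y} \<in> E) xs)"

definition graph_cycle :: "'v set set \<Rightarrow> 'v list \<Rightarrow> bool" where
  "graph_cycle E xs \<longleftrightarrow>
     length xs \<ge> 3 \<and> distinct xs \<and> successively (\<lambda>x y. {x, y} \<in> E) xs \<and>
     {last xs, hd xs} \<in> E"

definition tree :: "'v set \<Rightarrow> 'v set set \<Rightarrow> bool" where
  "tree V E \<longleftrightarrow> simple_graph V E \<and> connected_graph V E \<and> (\<nexists>xs. graph_cycle E xs)"


section \<open>Temporal cost graphs\<close>

text \<open>The time labels are \<open>{1..horizon}\<close>. The cost function is total in HOL; its values outside
  the vertex set and the time labels are unconstrained, and no notion below depends on them (a
  machine lookup outside this domain returns an arbitrary value).\<close>

record 'v tcg =
  verts :: "'v set"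
  edges :: "'v set set"
  horizon :: nat
  cost :: "'v \<Rightarrow> 'v \<Rightarrow> nat \<Rightarrow> nat \<Rightarrow> enat"

definition temporal_cost_graph :: "'v tcg \<Rightarrow> bool" where
  "temporal_cost_graph G \<longleftrightarrow>
     simple_graph (verts G) (edges G) \<and>
     (\<forall>u\<in>verts G. \<forall>v\<in>verts G. \<forall>t\<in>{1..horizon G}. \<forall>t'\<in>{1..horizon G}.
        (t \<ge> t' \<longrightarrow> cost G u v t t' = \<infinity>) \<and>
        (t < t' \<longrightarrow> cost G v v t t' = 0) \<and>
        (u \<noteq> v \<longrightarrow> cost G u v t t' > 0))"

definition is_lifetime :: "'v tcg \<Rightarrow> nat \<Rightarrow> bool" where
  "is_lifetime G T \<longleftrightarrow>
     (let finite_arrivals = {t' \<in> {1..horizon G}.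
            \<exists>v\<in>verts G. \<exists>u\<in>verts G. \<exists>t\<in>{1..horizon G}. cost G v u t t' < \<infinity>}
      in T \<in> finite_arrivals \<and> (\<forall>t'\<in>finite_arrivals. t' \<le> T))"

text \<open>Walks move along edges of the static graph, or stay at a vertex (where the cost is 0). The
  cost function is not required to be infinite on pairs of distinct non-adjacent vertices; the
  condition on the step makes its values there irrelevant, and holds automatically if they are
  infinite.\<close>

type_synonym 'v step = "'v \<times> 'v \<times> nat \<times> nat"

definition valid_walk :: "'v tcg \<Rightarrow> 'v step list \<Rightarrow> bool" where
  "valid_walk G ws \<longleftrightarrow>
     (\<forall>(u, v, t, t')\<in>set ws.
        u \<in> verts G \<and> v \<in> verts G \<and> (u = v \<or> {u, v} \<in> edges G) \<and>
        t \<in> {1..horizon G} \<and> t' \<in> {1..horizon G} \<and> t < t' \<and> cost G u v t t' < \<infinity>) \<and>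
     successively (\<lambda>(_, v, _, t') (u, _, t, _). v = u \<and> t' \<le> t) ws"

definition walk_cost :: "'v tcg \<Rightarrow> 'v step list \<Rightarrow> enat" where
  "walk_cost G ws = (\<Sum>(u, v, t, t')\<leftarrow>ws. cost G u v t t')"

definition visited :: "'v step list \<Rightarrow> 'v set" where
  "visited ws = (\<Union>(u, v, _, _)\<in>set ws. {u, v})"

text \<open>The maximum below is over a finite set containing 0 whenever \<open>G\<close> is a temporal cost graph and
  \<open>u\<close>, \<open>v\<close> are vertices: every pair \<open>(t, t')\<close> with finite cost satisfies \<open>t < t'\<close>.\<close>

definition max_traversal_number :: "'v tcg \<Rightarrow> 'v \<Rightarrow> 'v \<Rightarrow> nat" where
  "max_traversal_number G u v =
     Max {length ps | ps.
       (\<forall>(t, t')\<in>set ps. t \<in> {1..horizon G} \<and> t' \<in> {1..horizon G} \<and>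
          min (cost G u v t t') (cost G v u t t') < \<infinity>) \<and>
       successively (\<lambda>(_, t') (t, _). t' \<le> t) ps}"


section \<open>Changing Cost Temporal Orienteering\<close>

record 'v ccto =
  graph :: "'v tcg"
  source :: 'v
  sink :: 'v
  quota :: nat
  budget :: nat

definition ccto_instance :: "'v ccto \<Rightarrow> bool" where
  "ccto_instance I \<longleftrightarrow>
     temporal_cost_graph (graph I) \<and> source I \<in> verts (graph I) \<and> sink I \<in> verts (graph I)"

definition ccto_yes :: "'v ccto \<Rightarrow> bool" where
  "ccto_yes I \<longleftrightarrow>
     (\<exists>ws. ws \<noteq> [] \<and> valid_walk (graph I) ws \<and>
        fst (hd ws) = source I \<and> fst (snd (last ws)) = sink I \<and>
        card (visited ws) \<ge> quota I \<and> walk_cost (graph I) ws \<le> enat (budget I))"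


section \<open>Random access machines with graph lookup\<close>

text \<open>Unit-cost RAM programs in structured form. A state consists of registers, which are addressed
  directly by the program, and memory, which is addressed indirectly through registers. Arithmetic
  is restricted to addition and truncated subtraction, as unit-cost multiplication could build
  numbers of exponential length. The last two instructions are the constant-time lookups of
  adjacency in the static graph and of the cost function.\<close>

type_synonym state = "(nat \<Rightarrow> nat) \<times> (nat \<Rightarrow> nat)"

datatype instr =
    Const nat nat
  | Add nat nat nat
  | Sub nat nat nat
  | Load nat nat
  | Store nat nat
  | Adjacent nat nat nat
  | Cost nat nat nat nat nat

datatype com =
    Do instr
  | Seq com com
  | IfLess nat nat com com
  | WhileLess nat nat com

fun cost_code :: "enat \<Rightarrow> nat" where
  "cost_code (enat c) = Suc c"
| "cost_code \<infinity> = 0"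

fun exec_instr :: "nat tcg \<Rightarrow> instr \<Rightarrow> state \<Rightarrow> state" where
  "exec_instr G (Const x c) (r, m) = (r(x := c), m)"
| "exec_instr G (Add x y z) (r, m) = (r(x := r y + r z), m)"
| "exec_instr G (Sub x y z) (r, m) = (r(x := r y - r z), m)"
| "exec_instr G (Load x y) (r, m) = (r(x := m (r y)), m)"
| "exec_instr G (Store x y) (r, m) = (r, m(r x := r y))"
| "exec_instr G (Adjacent x u v) (r, m) =
     (r(x := (if {r u, r v} \<in> edges G then 1 else 0)), m)"
| "exec_instr G (Cost x u v t t') (r, m) =
     (r(x := cost_code (cost G (r u) (r v) (r t) (r t'))), m)"

text \<open>\<open>exec G c \<sigma> k \<tau>\<close>: started in \<open>\<sigma>\<close>, the program \<open>c\<close> halts in \<open>\<tau>\<close> after exactly \<open>k\<close> steps, where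
  every instruction and every evaluation of a test is one step.\<close>

inductive exec :: "nat tcg \<Rightarrow> com \<Rightarrow> state \<Rightarrow> nat \<Rightarrow> state \<Rightarrow> bool" for G where
  Do: "exec G (Do i) \<sigma> 1 (exec_instr G i \<sigma>)"
| Seq: "exec G c\<^sub>1 \<sigma> k \<sigma>' \<Longrightarrow> exec G c\<^sub>2 \<sigma>' l \<tau> \<Longrightarrow> exec G (Seq c\<^sub>1 c\<^sub>2) \<sigma> (k + l) \<tau>"
| IfTrue: "fst \<sigma> x < fst \<sigma> y \<Longrightarrow> exec G c\<^sub>1 \<sigma> k \<tau> \<Longrightarrow>
    exec G (IfLess x y c\<^sub>1 c\<^sub>2) \<sigma> (Suc k) \<tau>"
| IfFalse: "\<not> fst \<sigma> x < fst \<sigma> y \<Longrightarrow> exec G c\<^sub>2 \<sigma> k \<tau> \<Longrightarrow>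
    exec G (IfLess x y c\<^sub>1 c\<^sub>2) \<sigma> (Suc k) \<tau>"
| WhileFalse: "\<not> fst \<sigma> x < fst \<sigma> y \<Longrightarrow> exec G (WhileLess x y c) \<sigma> 1 \<sigma>"
| WhileTrue: "fst \<sigma> x < fst \<sigma> y \<Longrightarrow> exec G c \<sigma> k \<sigma>' \<Longrightarrow> exec G (WhileLess x y c) \<sigma>' l \<tau> \<Longrightarrow>
    exec G (WhileLess x y c) \<sigma> (Suc (k + l)) \<tau>"

definition initial_state :: "nat ccto \<Rightarrow> state" where
  "initial_state I =
     ((\<lambda>_. 0)(0 := card (verts (graph I)), 1 := horizon (graph I), 2 := source I, 3 := sink I,
              4 := quota I, 5 := budget I),
      (\<lambda>_. 0))"

definition accepting :: "state \<Rightarrow> bool" where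
  "accepting \<sigma> \<longleftrightarrow> fst \<sigma> 0 \<noteq> 0"

text \<open>One fixed program decides all instances in the class \<open>A\<close> and takes \<open>O(b I)\<close> steps on
  instance \<open>I\<close>. The machine works with the vertices \<open>0, \<dots>, n - 1\<close>. Since every run takes at least
  one step, the bound is read as \<open>1\<close> where \<open>b I = 0\<close>.\<close>

definition ccto_solvable_in_time :: "(nat ccto \<Rightarrow> bool) \<Rightarrow> (nat ccto \<Rightarrow> nat) \<Rightarrow> bool" where
  "ccto_solvable_in_time A b \<longleftrightarrow>
     (\<exists>p c. \<forall>I. ccto_instance I \<and> verts (graph I) = {..<card (verts (graph I))} \<and> A I \<longrightarrow>
        (\<exists>k \<tau>. exec (graph I) p (initial_state I) k \<tau> \<and> k \<le> c * max 1 (b I) \<and>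
           (accepting \<tau> \<longleftrightarrow> ccto_yes I)))"

end

theory Submission
  imports Defs
begin

text \<open>A closed walk in a tree crosses every edge an even number of times, since deleting an edge separates
  its endpoints. A traversal number of at most 3 therefore forces every crossed edge to be crossed
  exactly twice, and as the crossed edges form a tree on the visited vertices, the walk makes
  exactly \<open>2 (m - 1)\<close> moves if it visits \<open>m\<close> vertices. So it suffices to decide whether there is a
  closed walk with at least \<open>2 (k - 1)\<close> moves within the budget. This no longer depends on which vertices
  were visited: a dynamic program over time, current vertex and number of moves (capped at
  \<open>2 (k - 1)\<close>) takes \<open>O(n\<^sup>2 T\<^sup>2 k)\<close> steps.\<close>


section \<open>Closed walks in trees\<close>

text \<open>The parity argument needs, for each crossed edge, a cut that this edge alone joins; the
  set reachable from one endpoint once the edge is deleted serves as one side. The bound 3 is the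
  largest that forces multiplicity two: if four crossings were allowed, the number of moves would no
  longer determine the number of visited vertices.

  A walk may start late, pause and end early, while the dynamic program wants a fixed start and end.
  Waiting is free and is no crossing, so waiting steps fill all gaps and every walk may be taken to
  run from time 1 to the horizon. A solution must also be a nonempty walk; the lifetime hypothesis
  yields a second time label, so that waiting at the source is always possible.

  The machine offers neither multiplication nor an equality test. Hence addresses advance by fixed
  strides, products arise by repeated addition, and \<open>u = v\<close> is detected by two
  comparisons.\<close>

lemma rtrancl_imp_distinct_path:
  assumes "(a, b) \<in> r\<^sup>*"
  shows "\<exists>xs. xs \<noteq> [] \<and> hd xs = a \<and> last xs = b \<and> distinct xs \<and> successively (\<lambda>x y. (x, y) \<in> r) xs"
  using assms
proof (induction rule: rtrancl_induct)
  case base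
  show ?case by (rule exI[of _ "[a]"]) simp
next
  case (step b c)
  then obtain xs where xs: "xs \<noteq> []" "hd xs = a" "last xs = b" "distinct xs"
    "successively (\<lambda>x y. (x, y) \<in> r) xs" by blast
  show ?case
  proof (cases "c \<in> set xs")
    case True
    \<comment> \<open>The new endpoint already lies on the path, so the path is cut at that
      occurrence.\<close>
    then obtain ys zs where "xs = ys @ c # zs" by (auto simp: in_set_conv_decomp)
    with xs show ?thesis
      by (intro exI[of _ "ys @ [c]"]) (auto simp: successively_append_iff hd_append)
  next
    case False
    with xs step show ?thesis
      by (intro exI[of _ "xs @ [c]"]) (auto simp: successively_append_iff)
  qed
qed

definition adj :: "'v set set \<Rightarrow> ('v \<times> 'v) set" where
  "adj E = {(x, y). {x, y} \<in> E}"

text \<open>A simple path from \<open>a\<close> to \<open>b\<close> inside \<open>F\<close> would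
  close up with the edge \<open>{a, b}\<close> to a cycle. It has at least three vertices, since a
  path on two would use the excluded edge. \<open>F\<close> is later either the set of edges crossed
  so far or all edges but one.\<close>

lemma not_reachable_if_acyclic:
  assumes acyclic: "\<nexists>xs. graph_cycle E xs"
    and e: "{a, b} \<in> E" "a \<noteq> b" and F: "F \<subseteq> E" "{a, b} \<notin> F"
  shows "(a, b) \<notin> (adj F)\<^sup>*"
proof
  assume "(a, b) \<in> (adj F)\<^sup>*"
  from rtrancl_imp_distinct_path[OF this] obtain xs where
    xs: "xs \<noteq> []" "hd xs = a" "last xs = b" "distinct xs"
    "successively (\<lambda>x y. (x, y) \<in> adj F) xs" by blast
  obtain ys where ys: "xs = a # ys" using xs(1,2) by (cases xs) auto
  obtain y zs where zs: "ys = y # zs" using xs(3) e(2) ys by (cases ys) auto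
  have "{a, y} \<in> F" using xs(5) ys zs by (simp add: adj_def)
  then have "zs \<noteq> []" using F(2) xs(3) ys zs by auto
  then have "length xs \<ge> 3" using ys zs by (cases zs) auto
  moreover have "successively (\<lambda>x y. {x, y} \<in> E) xs"
    by (rule successively_mono[OF xs(5)]) (use F(1) in \<open>auto simp: adj_def\<close>)
  moreover have "{last xs, hd xs} \<in> E" using e xs by (simp add: insert_commute)
  ultimately have "graph_cycle E xs" using xs(4) by (simp add: graph_cycle_def)
  then show False using acyclic by blast
qed

section \<open>Edges crossed by a walk: their number and their parity\<close>

definition crossings :: "'v step list \<Rightarrow> 'v set list" where
  "crossings ws = map (\<lambda>(u, v, _, _). {u, v}) (filter (\<lambda>(u, v, _, _). u \<noteq> v) ws)"

lemma crossings_simps [simp]: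
  "crossings [] = []"
  "crossings ((u, v, t, t') # ws) = (if u = v then crossings ws else {u, v} # crossings ws)"
  "crossings (ws @ ws') = crossings ws @ crossings ws'"
  by (auto simp: crossings_def)

lemma visited_simps [simp]:
  "visited [] = {}"
  "visited ((u, v, t, t') # ws) = {u, v} \<union> visited ws"
  "visited (ws @ ws') = visited ws \<union> visited ws'"
  by (auto simp: visited_def)

lemma walk_cost_simps [simp]:
  "walk_cost G [] = 0"
  "walk_cost G ((u, v, t, t') # ws) = cost G u v t t' + walk_cost G ws"
  "walk_cost G (ws @ ws') = walk_cost G ws + walk_cost G ws'"
  by (auto simp: walk_cost_def)

lemma finite_visited [simp]: "finite (visited ws)"
  by (auto simp: visited_def)

definition valid_step :: "'v tcg \<Rightarrow> 'v step \<Rightarrow> bool" where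
  "valid_step G = (\<lambda>(u, v, t, t').
     u \<in> verts G \<and> v \<in> verts G \<and> (u = v \<or> {u, v} \<in> edges G) \<and>
     t \<in> {1..horizon G} \<and> t' \<in> {1..horizon G} \<and> t < t' \<and> cost G u v t t' < \<infinity>)"

lemma valid_walk_Nil: "valid_walk G []"
  by (simp add: valid_walk_def)

lemma valid_walk_snoc:
  "valid_walk G (ws @ [(u, v, t, t')]) \<longleftrightarrow>
     valid_walk G ws \<and> valid_step G (u, v, t, t') \<and>
     (ws \<noteq> [] \<longrightarrow> fst (snd (last ws)) = u \<and> snd (snd (snd (last ws))) \<le> t)"
  by (auto simp: valid_walk_def valid_step_def successively_append_iff split: prod.splits)

lemma valid_walk_Cons:
  "valid_walk G ((u, v, t, t') # ws) \<longleftrightarrow>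
     valid_walk G ws \<and> valid_step G (u, v, t, t') \<and>
     (ws \<noteq> [] \<longrightarrow> fst (hd ws) = v \<and> t' \<le> fst (snd (snd (hd ws))))"
  by (cases ws) (auto simp: valid_walk_def valid_step_def split: prod.splits)

text \<open>The crossed edges grow as a tree, one new vertex per new edge. The reachability conjunct
  carries the induction: if a new edge \<open>{u, v}\<close> led to a visited \<open>v\<close>, then
  \<open>v\<close> would be reachable from \<open>u\<close> along other edges, against
  acyclicity.\<close>

lemma card_visited_acyclic:
  assumes "valid_walk G ws" "ws \<noteq> []" and acyclic: "\<nexists>xs. graph_cycle (edges G) xs"
  shows "card (visited ws) = Suc (card (set (crossings ws))) \<and> fst (snd (last ws)) \<in> visited ws \<and>
    set (crossings ws) \<subseteq> edges G \<and> \<Union> (set (crossings ws)) \<subseteq> visited ws \<and>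
    (\<forall>x\<in>visited ws. (fst (snd (last ws)), x) \<in> (adj (set (crossings ws)))\<^sup>*)"
  using assms(2,1)
proof (induction ws rule: rev_nonempty_induct)
  case (single x)
  obtain u v t t' where x: "x = (u, v, t, t')" by (cases x) auto
  have "u = v \<or> {u, v} \<in> edges G"
    using single by (simp add: x valid_walk_Cons valid_step_def)
  then show ?case
    by (auto simp: x adj_def insert_commute)
next
  case (snoc x ws)
  obtain u v t t' where x: "x = (u, v, t, t')" by (cases x) auto
  from snoc have ws: "valid_walk G ws" "valid_step G (u, v, t, t')" "fst (snd (last ws)) = u"
    by (auto simp: x valid_walk_snoc)
  note IH = snoc.IH[OF ws(1), unfolded ws(3)]
  have uv: "u = v \<or> {u, v} \<in> edges G" using ws(2) by (simp add: valid_step_def)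
  show ?case
  proof (cases "u = v \<or> {u, v} \<in> set (crossings ws)")
    case True
    then have "insert {u, v} (set (crossings ws)) = set (crossings ws)" if "u \<noteq> v"
      using that by auto
    then have cr: "set (crossings (ws @ [x])) = set (crossings ws)"
      using x by auto
    have "v \<in> visited ws" using True IH by auto
    then have vi: "visited (ws @ [x]) = visited ws" using IH x by auto
    have "(v, u) \<in> (adj (set (crossings ws)))\<^sup>*"
      using True by (auto simp: adj_def insert_commute)
    then show ?thesis
      using IH \<open>v \<in> visited ws\<close> unfolding cr vi by (auto simp: x intro: rtrancl_trans)
  next
    case False
    have v: "v \<notin> visited ws"
      using not_reachable_if_acyclic[OF acyclic, of u v "set (crossings ws)"] False uv IH by auto
    have cr: "set (crossings (ws @ [x])) = insert {u, v} (set (crossings ws))"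
      using x False by auto
    have vi: "visited (ws @ [x]) = insert v (visited ws)" using IH x by auto
    have mono: "(adj (set (crossings ws)))\<^sup>* \<subseteq> (adj (insert {u, v} (set (crossings ws))))\<^sup>*"
      by (rule rtrancl_mono) (auto simp: adj_def)
    have "(v, u) \<in> adj (insert {u, v} (set (crossings ws)))"
      by (auto simp: adj_def)
    then have "(v, y) \<in> (adj (insert {u, v} (set (crossings ws))))\<^sup>*" if "y \<in> insert v (visited ws)" for y
      using that IH mono by (auto intro: converse_rtrancl_into_rtrancl)
    then show ?thesis
      using IH v False uv unfolding cr vi by (auto simp: x)
  qed
qed

text \<open>\<open>C\<close> is one side of a cut joined by \<open>{a, b}\<close> alone, so exactly
  the crossings of this edge change sides.\<close>

lemma even_crossings_iff:
  assumes "valid_walk G ws" "ws \<noteq> []" "a \<noteq> b"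
    and side: "\<And>u v. {u, v} \<in> edges G \<Longrightarrow> (u \<in> C \<longleftrightarrow> v \<in> C) \<longleftrightarrow> {u, v} \<noteq> {a, b}"
  shows "even (count_list (crossings ws) {a, b}) \<longleftrightarrow>
    (fst (hd ws) \<in> C \<longleftrightarrow> fst (snd (last ws)) \<in> C)"
  using assms(2,1)
proof (induction ws rule: list_nonempty_induct)
  case (single x)
  then show ?case
    using side by (cases x) (auto simp: valid_walk_Cons valid_step_def)
next
  case (cons x ws)
  then show ?case
    using side by (cases x) (auto simp: valid_walk_Cons valid_step_def)
qed

lemma even_crossings_closed:
  assumes "valid_walk G ws" "ws \<noteq> []" "fst (hd ws) = fst (snd (last ws))"
    and acyclic: "\<nexists>xs. graph_cycle (edges G) xs" and ab: "{a, b} \<in> edges G" "a \<noteq> b"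
  shows "even (count_list (crossings ws) {a, b})"
proof -
  define r where "r = adj (edges G - {{a, b}})"
  have b: "(a, b) \<notin> r\<^sup>*"
    unfolding r_def by (rule not_reachable_if_acyclic[OF acyclic ab]) auto
  have "(a, u) \<in> r\<^sup>* \<longleftrightarrow> (a, v) \<in> r\<^sup>*" if "{u, v} \<in> edges G" "{u, v} \<noteq> {a, b}" for u v
  proof -
    have "(u, v) \<in> r" "(v, u) \<in> r" using that by (auto simp: r_def adj_def insert_commute)
    then show ?thesis by (meson rtrancl.rtrancl_into_rtrancl)
  qed
  \<comment> \<open>The side is the set of vertices reachable from \<open>a\<close> without the edge
    \<open>{a, b}\<close>.\<close>
  then have "(u \<in> {x. (a, x) \<in> r\<^sup>*} \<longleftrightarrow> v \<in> {x. (a, x) \<in> r\<^sup>*}) \<longleftrightarrow> {u, v} \<noteq> {a, b}"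
    if "{u, v} \<in> edges G" for u v
    using that b by (auto simp: doubleton_eq_iff)
  from even_crossings_iff[OF assms(1,2) ab(2) this] show ?thesis using assms(3) by simp
qed

section \<open>Crossings of one edge against its traversal number\<close>

definition disjoint_traversals :: "'v tcg \<Rightarrow> 'v \<Rightarrow> 'v \<Rightarrow> (nat \<times> nat) list \<Rightarrow> bool" where
  "disjoint_traversals G u v ps \<longleftrightarrow>
       (\<forall>(t, t')\<in>set ps. t \<in> {1..horizon G} \<and> t' \<in> {1..horizon G} \<and>
          min (cost G u v t t') (cost G v u t t') < \<infinity>) \<and>
       successively (\<lambda>(_, t') (t, _). t' \<le> t) ps"

text \<open>\<open>Max\<close> is informative only on a finite set. Finite cost forces
  \<open>t < t'\<close>, so departure times strictly increase within \<open>{1..horizon G}\<close>,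
  which bounds all lengths by the horizon.\<close>

lemma length_le_max_traversal_number:
  assumes G: "temporal_cost_graph G" and uv: "u \<in> verts G" "v \<in> verts G"
    and ps: "disjoint_traversals G u v ps"
  shows "length ps \<le> max_traversal_number G u v"
proof -
  have bound: "length qs \<le> horizon G" if qs: "disjoint_traversals G u v qs" for qs
  proof -
    have lt: "t < t'" if "(t, t') \<in> set qs" for t t'
    proof (rule ccontr)
      assume "\<not> t < t'"
      moreover have "t \<in> {1..horizon G}" "t' \<in> {1..horizon G}"
        "min (cost G u v t t') (cost G v u t t') < \<infinity>"
        using that qs by (auto simp: disjoint_traversals_def)
      ultimately show False
        using G uv by (auto simp: temporal_cost_graph_def min_def split: if_splits)
    qed
    have "successively (\<lambda>p q. fst p < fst q) qs"
      by (rule successively_mono[of "\<lambda>(_, t') (t, _). t' \<le> t"])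
        (use qs lt in \<open>fastforce simp: disjoint_traversals_def\<close>)+
    then have "sorted_wrt (<) (map fst qs)"
      by (simp add: sorted_wrt_map successively_conv_sorted_wrt transp_def)
    then have "distinct (map fst qs)" by (simp add: strict_sorted_iff)
    then have "length qs = card (set (map fst qs))" using distinct_card by fastforce
    also have "\<dots> \<le> card {1..horizon G}"
      by (rule card_mono) (use qs in \<open>auto simp: disjoint_traversals_def\<close>)
    finally show ?thesis by simp
  qed
  have "max_traversal_number G u v = Max {length ps | ps. disjoint_traversals G u v ps}"
    by (simp add: max_traversal_number_def disjoint_traversals_def)
  moreover have "finite {length ps | ps. disjoint_traversals G u v ps}"
    by (rule finite_subset[of _ "{..horizon G}"]) (use bound in auto)
  ultimately show ?thesis using ps by (auto intro!: Max_ge)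
qed

lemma count_crossings_le:
  assumes G: "temporal_cost_graph G" and ws: "valid_walk G ws"
    and ab: "{a, b} \<in> edges G" "a \<noteq> b"
  shows "count_list (crossings ws) {a, b} \<le> max_traversal_number G a b"
proof -
  define fs where "fs = filter (\<lambda>(u, v, _, _). {u, v} = {a, b}) ws"
  define ps where "ps = map (snd \<circ> snd) fs"
  have ab_verts: "a \<in> verts G" "b \<in> verts G"
    using G ab unfolding temporal_cost_graph_def simple_graph_def by (metis insert_iff doubleton_eq_iff)+
  have "count_list (crossings ws) {a, b} = length ps"
    unfolding ps_def fs_def using ab(2) by (induction ws) (auto simp: doubleton_eq_iff split: if_splits)
  also have "disjoint_traversals G a b ps"
    unfolding disjoint_traversals_def
  proof
    have "t \<in> {1..horizon G} \<and> t' \<in> {1..horizon G} \<and> min (cost G a b t t') (cost G b a t t') < \<infinity>"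
      if "(t, t') \<in> set ps" for t t'
    proof -
      have "\<exists>u v. (u, v, t, t') \<in> set fs"
        using that by (force simp: ps_def)
      then obtain u v where uv: "(u, v, t, t') \<in> set ws" "{u, v} = {a, b}"
        unfolding fs_def by auto
      then have "t \<in> {1..horizon G}" "t' \<in> {1..horizon G}" "cost G u v t t' < \<infinity>"
        using ws by (auto simp: valid_walk_def)
      moreover have "u = a \<and> v = b \<or> u = b \<and> v = a" using uv(2) by (simp add: doubleton_eq_iff)
      ultimately show ?thesis by (metis min.strict_coboundedI1 min.strict_coboundedI2)
    qed
    then show "\<forall>(t, t')\<in>set ps. t \<in> {1..horizon G} \<and> t' \<in> {1..horizon G} \<and>
          min (cost G a b t t') (cost G b a t t') < \<infinity>"
      by blast
    have step: "t < t'" if "(u, v, t, t') \<in> set ws" for u v t t'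
      using that ws by (auto simp: valid_walk_def)
    \<comment> \<open>Filtering destroys adjacency, so the order must hold between all pairs of
      steps. \<open>t1' \<le> t2\<close> alone is not transitive; together with
      \<open>t < t'\<close> for both steps it is.\<close>
    let ?P = "\<lambda>(_, _, t1, t1') (_, _, t2, t2'). t1' \<le> t2 \<and> t1 < t1' \<and> t2 < (t2'::nat)"
    have "successively ?P ws"
    proof (rule successively_mono)
      show "successively (\<lambda>(_, v, _, t') (u, _, t, _). v = u \<and> t' \<le> t) ws"
        using ws by (simp add: valid_walk_def)
    qed (use step in auto)
    moreover have "transp ?P" by (auto simp: transp_def)
    ultimately have "sorted_wrt ?P ws" using successively_conv_sorted_wrt by blast
    then have "sorted_wrt ?P fs" unfolding fs_def by (rule sorted_wrt_filter)
    then have "sorted_wrt (\<lambda>(_, t') (t, _). t' \<le> t) ps"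
      unfolding ps_def sorted_wrt_map by (rule sorted_wrt_mono_rel[rotated]) auto
    then show "successively (\<lambda>(_, t') (t, _). t' \<le> t) ps"
      by (rule successively_if_sorted_wrt)
  qed
  then have "length ps \<le> max_traversal_number G a b"
    by (rule length_le_max_traversal_number[OF G ab_verts])
  finally show ?thesis .
qed

lemma length_crossings_closed:
  assumes G: "temporal_cost_graph G" and acyclic: "\<nexists>xs. graph_cycle (edges G) xs"
    and trav: "\<forall>u v. {u, v} \<in> edges G \<longrightarrow> max_traversal_number G u v \<le> 3"
    and ws: "valid_walk G ws" "ws \<noteq> []" "fst (hd ws) = fst (snd (last ws))"
  shows "length (crossings ws) = 2 * (card (visited ws) - 1)"
proof -
  note V = card_visited_acyclic[OF ws(1,2) acyclic]
  have "count_list (crossings ws) e = 2" if e: "e \<in> set (crossings ws)" for e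
  proof -
    obtain a b where ab: "e = {a, b}" "a \<noteq> b"
      using e by (auto simp: crossings_def)
    have abE: "{a, b} \<in> edges G" using e V ab by auto
    have "even (count_list (crossings ws) e)"
      using even_crossings_closed[OF ws acyclic abE ab(2)] ab by simp
    moreover have "count_list (crossings ws) e \<le> 3"
      using count_crossings_le[OF G ws(1) abE ab(2)] trav abE ab(1) by fastforce
    moreover have "count_list (crossings ws) e \<noteq> 0"
      using e by (simp add: count_list_0_iff)
    ultimately show ?thesis by presburger
  qed
  then have "(\<Sum>e\<in>set (crossings ws). count_list (crossings ws) e) = 2 * card (set (crossings ws))"
    by simp
  then show ?thesis using V sum_count_set[of "crossings ws" "set (crossings ws)"] by simp
qed


section \<open>Walks and reachability\<close>

text \<open>\<open>reach G s t v j c\<close>: starting in \<open>s\<close> at time 1, one can be in \<open>v\<close> at time \<open>t\<close> after \<open>j\<close> moves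
  along edges of total cost \<open>c\<close>. Waiting steps do not count as moves.\<close>

inductive reach :: "'v tcg \<Rightarrow> 'v \<Rightarrow> nat \<Rightarrow> 'v \<Rightarrow> nat \<Rightarrow> nat \<Rightarrow> bool" for G s where
  start: "reach G s 1 s 0 0"
| step: "reach G s t u j c \<Longrightarrow> valid_step G (u, v, t, t') \<Longrightarrow> cost G u v t t' = enat w \<Longrightarrow>
    reach G s t' v (if u = v then j else Suc j) (c + w)"

lemma reach_imp_walk:
  assumes "reach G s t v j c"
  shows "(t = 1 \<and> v = s) \<or>
    (\<exists>ws. ws \<noteq> [] \<and> valid_walk G ws \<and> fst (hd ws) = s \<and> fst (snd (last ws)) = v \<and>
       snd (snd (snd (last ws))) = t \<and> length (crossings ws) = j \<and> walk_cost G ws = enat c)"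
    (is "?init t v \<or> ?walk t v j c")
proof -
  \<comment> \<open>The start corresponds to the empty walk, which has no endpoint or arrival time.
    Recording \<open>j = 0\<close> and \<open>c = 0\<close> there lets the first step become a walk
    with the right counts.\<close>
  have "(?init t v \<and> j = 0 \<and> c = 0) \<or> ?walk t v j c"
    using assms
  proof induction
    case start
    then show ?case by simp
  next
    case (step t u j c v t' w)
    from step.IH show ?case
    proof
      assume "?init t u \<and> j = 0 \<and> c = 0"
      then have "?walk t' v (if u = v then j else Suc j) (c + w)"
        using step.hyps(2,3)
        by (intro exI[of _ "[(u, v, t, t')]"]) (auto simp: valid_walk_Cons valid_walk_Nil)
      then show ?thesis ..
    next
      assume "?walk t u j c"
      then obtain ws where "ws \<noteq> []" "valid_walk G ws" "fst (hd ws) = s" "fst (snd (last ws)) = u"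
       "snd (snd (snd (last ws))) = t" "length (crossings ws) = j" "walk_cost G ws = enat c"
        by blast
      then have "?walk t' v (if u = v then j else Suc j) (c + w)"
        using step.hyps(2,3)
        by (intro exI[of _ "ws @ [(u, v, t, t')]"]) (auto simp: valid_walk_snoc)
      then show ?thesis ..
    qed
  qed
  then show ?thesis by blast
qed

lemma valid_step_wait:
  assumes "temporal_cost_graph G" "v \<in> verts G" "1 \<le> t" "t < t'" "t' \<le> horizon G"
  shows "valid_step G (v, v, t, t')" "cost G v v t t' = 0"
  using assms by (auto simp: valid_step_def temporal_cost_graph_def zero_enat_def)

text \<open>This lets the final test look at the horizon only, although a walk may end
  earlier.\<close>

lemma reach_wait:
  assumes "reach G s t v j c" "temporal_cost_graph G" "v \<in> verts G" "1 \<le> t" "t \<le> t'"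
    "t' \<le> horizon G"
  shows "reach G s t' v j c"
proof (cases "t = t'")
  case False
  with assms have "t < t'" by simp
  note w = valid_step_wait[OF assms(2-4) this assms(6)]
  show ?thesis
    using reach.step[OF assms(1) w(1), of 0] w(2) by (simp add: zero_enat_def)
qed (use assms in simp)

lemma valid_walk_arrival:
  assumes "valid_walk G ws" "ws \<noteq> []"
  shows "1 \<le> snd (snd (snd (last ws))) \<and> snd (snd (snd (last ws))) \<le> horizon G"
proof -
  obtain xs u v t t' where "ws = xs @ [(u, v, t, t')]"
    using assms(2) by (metis append_butlast_last_id prod_cases4)
  then show ?thesis using assms(1) by (simp add: valid_walk_snoc valid_step_def)
qed

text \<open>\<open>reach\<close> demands that each departure time equals the previous arrival time.
  Gaps in the walk, including the one before its first departure, are closed by waiting.\<close>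

lemma walk_imp_reach:
  assumes G: "temporal_cost_graph G"
    and "ws \<noteq> []" "valid_walk G ws" "fst (hd ws) = s"
  shows "\<exists>c. walk_cost G ws = enat c \<and>
     reach G s (snd (snd (snd (last ws)))) (fst (snd (last ws))) (length (crossings ws)) c"
  using assms(2-)
proof (induction ws rule: rev_nonempty_induct)
  case (single x)
  obtain u v t t' where x: "x = (u, v, t, t')" by (cases x) auto
  have st: "valid_step G (u, v, t, t')" and s: "u = s"
    using single by (auto simp: x valid_walk_Cons)
  obtain w where w: "cost G u v t t' = enat w" using st by (auto simp: valid_step_def)
  have "reach G s t u 0 0"
    using reach_wait[OF reach.start G] st s by (auto simp: valid_step_def)
  from reach.step[OF this st w] show ?case using w by (auto simp: x)
next
  case (snoc x ws)
  obtain u v t t' where x: "x = (u, v, t, t')" by (cases x) auto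
  have ws: "valid_walk G ws" and st: "valid_step G (u, v, t, t')"
    and last: "fst (snd (last ws)) = u" "snd (snd (snd (last ws))) \<le> t"
    using snoc.prems snoc.hyps by (auto simp: x valid_walk_snoc)
  have "1 \<le> snd (snd (snd (last ws)))"
    using valid_walk_arrival[OF ws] snoc.hyps by simp
  obtain w where w: "cost G u v t t' = enat w" using st by (auto simp: valid_step_def)
  obtain c where c: "walk_cost G ws = enat c"
    "reach G s (snd (snd (snd (last ws)))) u (length (crossings ws)) c"
    using snoc.IH[OF ws] snoc.prems snoc.hyps last by auto
  have "reach G s t u (length (crossings ws)) c"
    by (rule reach_wait[OF c(2) G _ \<open>1 \<le> _\<close> last(2)]) (use st in \<open>auto simp: valid_step_def\<close>)
  from reach.step[OF this st w] show ?case using w c(1) by (auto simp: x)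
qed

lemma ccto_yes_iff_reach:
  assumes I: "ccto_instance I" and closed: "source I = sink I"
    and lifetime: "is_lifetime (graph I) (horizon (graph I))"
    and acyclic: "\<nexists>xs. graph_cycle (edges (graph I)) xs"
    and trav: "\<forall>u v. {u, v} \<in> edges (graph I) \<longrightarrow> max_traversal_number (graph I) u v \<le> 3"
  shows "ccto_yes I \<longleftrightarrow>
    (\<exists>j c. reach (graph I) (source I) (horizon (graph I)) (source I) j c \<and>
       2 * (quota I - 1) \<le> j \<and> c \<le> budget I)"
proof -
  let ?G = "graph I"
  have G: "temporal_cost_graph ?G" and s: "source I \<in> verts ?G"
    using I by (auto simp: ccto_instance_def)
  \<comment> \<open>An arrival at the horizon with finite cost departs strictly earlier. Being at
    the source at the horizon is therefore never the initial case of \<open>reach_imp_walk\<close>,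
    and a nonempty walk results.\<close>
  have T: "1 < horizon ?G"
  proof -
    obtain u v t where uv: "u \<in> verts ?G" "v \<in> verts ?G" "t \<in> {1..horizon ?G}"
      "horizon ?G \<in> {1..horizon ?G}" "cost ?G v u t (horizon ?G) < \<infinity>"
      using lifetime by (auto simp: is_lifetime_def Let_def)
    have "cost ?G v u t (horizon ?G) = \<infinity>" if "t \<ge> horizon ?G"
      using G uv(1-4) that unfolding temporal_cost_graph_def by blast
    then have "t < horizon ?G" using uv(5) by fastforce
    then show ?thesis using uv(3) by simp
  qed
  \<comment> \<open>At least one vertex is visited, so subtracting 1 on both sides is harmless even
    where it truncates for quota 0.\<close>
  have count: "quota I \<le> card (visited ws) \<longleftrightarrow> 2 * (quota I - 1) \<le> length (crossings ws)"
    if "valid_walk ?G ws" "ws \<noteq> []" "fst (hd ws) = fst (snd (last ws))" for ws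
  proof -
    have "card (visited ws) \<noteq> 0"
      using card_visited_acyclic[OF that(1,2) acyclic] by simp
    then show ?thesis unfolding length_crossings_closed[OF G acyclic trav that] by linarith
  qed
  show ?thesis
  proof
    assume "ccto_yes I"
    then obtain ws where ws: "ws \<noteq> []" "valid_walk ?G ws" "fst (hd ws) = source I"
      "fst (snd (last ws)) = source I" "quota I \<le> card (visited ws)"
      "walk_cost ?G ws \<le> enat (budget I)"
      using closed by (auto simp: ccto_yes_def)
    obtain c where c: "walk_cost ?G ws = enat c"
      "reach ?G (source I) (snd (snd (snd (last ws)))) (source I) (length (crossings ws)) c"
      using walk_imp_reach[OF G ws(1,2,3)] ws(4) by auto
    have "1 \<le> snd (snd (snd (last ws)))" "snd (snd (snd (last ws))) \<le> horizon ?G"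
      using valid_walk_arrival[OF ws(2,1)] by simp_all
    then have "reach ?G (source I) (horizon ?G) (source I) (length (crossings ws)) c"
      using reach_wait[OF c(2) G s] by blast
    then show "\<exists>j c. reach ?G (source I) (horizon ?G) (source I) j c \<and>
       2 * (quota I - 1) \<le> j \<and> c \<le> budget I"
      using count[OF ws(2,1)] ws c(1) by auto
  next
    assume "\<exists>j c. reach ?G (source I) (horizon ?G) (source I) j c \<and>
       2 * (quota I - 1) \<le> j \<and> c \<le> budget I"
    then obtain j c where "reach ?G (source I) (horizon ?G) (source I) j c"
      "2 * (quota I - 1) \<le> j" "c \<le> budget I" by blast
    with reach_imp_walk[OF this(1)] T obtain ws where "ws \<noteq> []" "valid_walk ?G ws"
      "fst (hd ws) = source I" "fst (snd (last ws)) = source I"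
      "2 * (quota I - 1) \<le> length (crossings ws)" "walk_cost ?G ws \<le> enat (budget I)"
      by auto
    then show "ccto_yes I" using closed count[of ws] by (auto simp: ccto_yes_def)
  qed
qed


section \<open>The table of the dynamic program\<close>

text \<open>The cell of \<open>t\<close>, \<open>v\<close>, \<open>j\<close> holds the largest value of \<open>b + 1 - c\<close> over all costs \<open>c\<close> of reaching \<open>v\<close> at
  time \<open>t\<close> with at least \<open>j\<close> moves, and 0 if every such cost exceeds the budget \<open>b\<close>. Thus the zeroed
  memory needs no initialisation, truncated subtraction discards walks over budget, and
  truncation of \<open>j - 1\<close> at \<open>j = 0\<close> is what \<open>at least j moves\<close> requires.\<close>

definition address :: "nat \<Rightarrow> nat \<Rightarrow> nat \<Rightarrow> nat \<Rightarrow> nat \<Rightarrow> nat" where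
  "address n L t v j = t * (n * L) + v * L + j"

lemma address_eq_iff:
  assumes "v < n" "j < L" "v' < n" "j' < L"
  shows "address n L t v j = address n L t' v' j' \<longleftrightarrow> t = t' \<and> v = v' \<and> j = j'"
proof
  have *: "address n L t v j = (t * n + v) * L + j" for t v j
    by (simp add: address_def algebra_simps)
  assume "address n L t v j = address n L t' v' j'"
  then have eq: "(t * n + v) * L + j = (t' * n + v') * L + j'" by (simp add: *)
  from arg_cong[OF eq, of "\<lambda>x. x mod L"] have j: "j = j'" using assms by simp
  with eq assms have "t * n + v = t' * n + v'" by simp
  moreover from arg_cong[OF this, of "\<lambda>x. x mod n"] have "v = v'" using assms by simp
  ultimately show "t = t' \<and> v = v' \<and> j = j'" using j assms by simp
qed simp

definition relax :: "nat tcg \<Rightarrow> nat \<Rightarrow> nat \<Rightarrow> nat \<times> nat \<times> nat \<times> nat \<times> nat \<Rightarrow> (nat \<Rightarrow> nat) \<Rightarrow> nat \<Rightarrow> nat" where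
  "relax G n L = (\<lambda>(t', t, v, u, j) m.
     if valid_step G (u, v, t, t')
     then m(address n L t' v j :=
       max (m (address n L t' v j))
         (m (address n L t u (if u = v then j else j - 1)) - the_enat (cost G u v t t')))
     else m)"

text \<open>Arrival time is outermost, so all entries for time \<open>t\<close> are complete before
  they serve as departures. The remaining order is that of the program's loops.\<close>

definition schedule :: "nat \<Rightarrow> nat \<Rightarrow> nat \<Rightarrow> (nat \<times> nat \<times> nat \<times> nat \<times> nat) list" where
  "schedule n L T =
     concat (map (\<lambda>t'. concat (map (\<lambda>t. concat (map (\<lambda>v. concat (map (\<lambda>u.
       map (\<lambda>j. (t', t, v, u, j)) [0..<L]) [0..<n])) [0..<n])) [1..<t'])) [1..<Suc T])"

definition initial_table :: "nat \<Rightarrow> nat \<Rightarrow> nat \<Rightarrow> nat \<Rightarrow> nat \<Rightarrow> nat" where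
  "initial_table n L s b = (\<lambda>_. 0)(address n L 1 s 0 := Suc b)"

lemma set_schedule:
  "(t', t, v, u, j) \<in> set (schedule n L T) \<longleftrightarrow>
     1 \<le> t \<and> t < t' \<and> t' \<le> T \<and> v < n \<and> u < n \<and> j < L"
proof -
  have eq: "set (schedule n L T) = (\<Union>t'\<in>{1..<Suc T}. \<Union>t\<in>{1..<t'}. \<Union>v\<in>{0..<n}. \<Union>u\<in>{0..<n}.
      (\<lambda>j. (t', t, v, u, j)) ` {0..<L})"
    by (simp add: schedule_def del: upt_Suc)
  show ?thesis
  proof
    assume "1 \<le> t \<and> t < t' \<and> t' \<le> T \<and> v < n \<and> u < n \<and> j < L"
    then show "(t', t, v, u, j) \<in> set (schedule n L T)"
      unfolding eq by (intro UN_I[of t'] UN_I[of t] UN_I[of v] UN_I[of u] imageI) auto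
  qed (auto simp: eq)
qed

lemma sorted_wrt_concat_map_upt:
  assumes "\<And>i x. x \<in> set (f i) \<Longrightarrow> g x = i"
  shows "sorted_wrt (\<lambda>x y. g x \<le> (g y :: nat)) (concat (map f [a..<b]))"
proof (induction b)
  case (Suc b)
  have "g (f b ! i) = b" if "i < length (f b)" for i
    using assms nth_mem[OF that] by blast
  then have "sorted_wrt (\<lambda>x y. g x \<le> g y) (f b)"
    by (simp add: sorted_wrt_iff_nth_less)
  then show ?case using Suc assms by (auto simp: sorted_wrt_append)
qed simp

lemma sorted_schedule: "sorted_wrt (\<lambda>x y. fst x \<le> fst y) (schedule n L T)"
  unfolding schedule_def by (rule sorted_wrt_concat_map_upt) auto

section \<open>Stability, soundness and completeness of the table\<close>

lemma relax_mono: "m x \<le> relax G n L q m x"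
  by (auto simp: relax_def split: prod.splits)

lemma fold_relax_mono: "m x \<le> fold (relax G n L) qs m x"
  by (induction qs arbitrary: m) (auto intro: order_trans relax_mono)

text \<open>A relaxation writes only a cell of its own arrival time; the bounds make addresses
  injective.\<close>

lemma fold_relax_other_time:
  assumes "\<And>t' t v u j. (t', t, v, u, j) \<in> set qs \<Longrightarrow> t' \<noteq> t0 \<and> v < n \<and> j < L" "v0 < n" "j0 < L"
  shows "fold (relax G n L) qs m (address n L t0 v0 j0) = m (address n L t0 v0 j0)"
  using assms(1)
proof (induction qs arbitrary: m)
  case (Cons q qs)
  obtain t' t v u j where q: "q = (t', t, v, u, j)" by (cases q) auto
  have "t' \<noteq> t0 \<and> v < n \<and> j < L" using Cons.prems[of t' t v u j] q by simp
  then have "relax G n L q m (address n L t0 v0 j0) = m (address n L t0 v0 j0)"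
    using assms(2,3) by (auto simp: relax_def q address_eq_iff)
  moreover have "fold (relax G n L) qs (relax G n L q m) (address n L t0 v0 j0)
      = relax G n L q m (address n L t0 v0 j0)"
    by (rule Cons.IH) (meson Cons.prems list.set_intros(2))
  ultimately show ?case by simp
qed simp

text \<open>A relaxation is never invalidated: since the schedule is sorted by arrival time, the source
  cell is final when it is read, and the target cell only grows afterwards.\<close>

lemma relaxed_in_final_table:
  fixes m :: "nat \<Rightarrow> nat"
  assumes "valid_step G (u, v, t, t')" "1 \<le> t" "t < t'" "t' \<le> T" "v < n" "u < n" "j < L"
  defines "M \<equiv> fold (relax G n L) (schedule n L T) m"
  shows "M (address n L t u (if u = v then j else j - 1)) - the_enat (cost G u v t t')
    \<le> M (address n L t' v j)"
proof -
  let ?q = "(t', t, v, u, j)" and ?src = "address n L t u (if u = v then j else j - 1)"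
  have "?q \<in> set (schedule n L T)" using assms by (simp add: set_schedule)
  then obtain ps qs where pq: "schedule n L T = ps @ ?q # qs" by (auto simp: in_set_conv_decomp)
  define m1 where "m1 = fold (relax G n L) ps m"
  have M: "M = fold (relax G n L) (?q # qs) m1" by (simp add: M_def pq m1_def)
  have "t1' \<noteq> t \<and> v1 < n \<and> j1 < L" if "(t1', t1, v1, u1, j1) \<in> set (?q # qs)" for t1' t1 v1 u1 j1
  proof -
    have "t' \<le> t1'"
      using sorted_schedule[of n L T] that unfolding pq by (fastforce simp: sorted_wrt_append)
    moreover have "(t1', t1, v1, u1, j1) \<in> set (schedule n L T)" using that unfolding pq by auto
    ultimately show ?thesis using assms by (simp add: set_schedule)
  qed
  then have "M ?src = m1 ?src"
    unfolding M by (rule fold_relax_other_time) (use assms in auto)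
  moreover have "m1 ?src - the_enat (cost G u v t t') \<le> relax G n L ?q m1 (address n L t' v j)"
    using assms(1) by (simp add: relax_def)
  moreover have "\<dots> \<le> M (address n L t' v j)" unfolding M by (simp add: fold_relax_mono)
  ultimately show ?thesis by simp
qed

text \<open>Only positive entries need a witness. For them the equation holds without truncation, so
  it yields \<open>c \<le> b\<close>.\<close>

definition sound_table :: "nat tcg \<Rightarrow> nat \<Rightarrow> nat \<Rightarrow> nat \<Rightarrow> nat \<Rightarrow> (nat \<Rightarrow> nat) \<Rightarrow> bool" where
  "sound_table G s n L b m \<longleftrightarrow> (\<forall>t v j. v < n \<longrightarrow> j < L \<longrightarrow> m (address n L t v j) > 0 \<longrightarrow>
     (\<exists>j' c. reach G s t v j' c \<and> j \<le> j' \<and> m (address n L t v j) + c = Suc b))"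

lemma sound_table_relax:
  assumes m: "sound_table G s n L b m" and q: "v < n" "u < n" "j < L"
  shows "sound_table G s n L b (relax G n L (t', t, v, u, j) m)"
  unfolding sound_table_def
proof (intro allI impI)
  fix t1 v1 j1
  let ?m = "relax G n L (t', t, v, u, j) m"
  let ?src = "address n L t u (if u = v then j else j - 1)"
  assume 1: "v1 < n" "j1 < L" "?m (address n L t1 v1 j1) > 0"
  show "\<exists>j' c. reach G s t1 v1 j' c \<and> j1 \<le> j' \<and> ?m (address n L t1 v1 j1) + c = Suc b"
  proof (cases "?m (address n L t1 v1 j1) = m (address n L t1 v1 j1)")
    case True
    then show ?thesis using m 1 unfolding sound_table_def by metis
  next
    case False
    then have st: "valid_step G (u, v, t, t')" and eq: "t1 = t'" "v1 = v" "j1 = j"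
      using 1 q by (auto simp: relax_def address_eq_iff split: if_splits)
    obtain w where w: "cost G u v t t' = enat w" using st by (auto simp: valid_step_def)
    have val: "?m (address n L t1 v1 j1) = m ?src - w"
      using False st w by (auto simp: relax_def eq max_def split: if_splits)
    \<comment> \<open>The subtraction did not truncate, so the source entry has a witness and its
      equation carries over exactly.\<close>
    then have pos: "m ?src > w" using 1 by simp
    have "(if u = v then j else j - 1) < L" using q by auto
    with m q pos obtain j' c where "reach G s t u j' c" "(if u = v then j else j - 1) \<le> j'"
      "m ?src + c = Suc b"
      unfolding sound_table_def by (metis gr_implies_not0 neq0_conv)
    with reach.step[OF this(1) st w] val pos show ?thesis
      by (intro exI[of _ "if u = v then j' else Suc j'"] exI[of _ "c + w"]) (auto simp: eq)
  qed
qed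

lemma sound_table_fold_relax:
  assumes "sound_table G s n L b m" "\<And>t' t v u j. (t', t, v, u, j) \<in> set qs \<Longrightarrow> v < n \<and> u < n \<and> j < L"
  shows "sound_table G s n L b (fold (relax G n L) qs m)"
  using assms
proof (induction qs arbitrary: m)
  case (Cons q qs)
  obtain t' t v u j where q: "q = (t', t, v, u, j)" by (cases q) auto
  have "sound_table G s n L b (relax G n L q m)"
    unfolding q using Cons.prems(2)[of t' t v u j] q by (intro sound_table_relax Cons.prems) auto
  then have "sound_table G s n L b (fold (relax G n L) qs (relax G n L q m))"
    by (rule Cons.IH) (meson Cons.prems(2) list.set_intros(2))
  then show ?case by simp
qed simp

text \<open>Completeness follows the derivation of \<open>reach\<close>. Truncated subtractions
  compose, \<open>(x - c) - w = x - (c + w)\<close>, so the bound survives even where the budget is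
  exceeded. The quantified \<open>j'\<close> is needed because a move asks its predecessor for one
  move fewer.\<close>

lemma final_table_ge:
  assumes G: "verts G = {..<n}" "horizon G = T" and s: "s < n"
    and "reach G s t v j c" "t \<le> T" "j' \<le> j" "j' < L"
  shows "Suc b - c \<le> fold (relax G n L) (schedule n L T) (initial_table n L s b) (address n L t v j')"
  using assms(4-)
proof (induction arbitrary: j' rule: reach.induct)
  case start
  have "Suc b = initial_table n L s b (address n L 1 s 0)" by (simp add: initial_table_def)
  also have "\<dots> \<le> fold (relax G n L) (schedule n L T) (initial_table n L s b) (address n L 1 s 0)"
    by (rule fold_relax_mono)
  finally show ?case using start by simp
next
  case (step t u j c v t' w)
  let ?M = "fold (relax G n L) (schedule n L T) (initial_table n L s b)"
  have "Suc b - c \<le> ?M (address n L t u (if u = v then j' else j' - 1))"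
    by (rule step.IH) (use step.hyps(2) step.prems in \<open>auto simp: valid_step_def split: if_splits\<close>)
  moreover have "?M (address n L t u (if u = v then j' else j' - 1)) - the_enat (cost G u v t t')
    \<le> ?M (address n L t' v j')"
    by (rule relaxed_in_final_table)
      (use step.hyps(2) step.prems G in \<open>simp_all add: valid_step_def\<close>)
  ultimately show ?case using step.hyps(3) by simp
qed

text \<open>Starting from \<open>Suc b\<close> keeps a walk that spends the whole budget, with value
  1, apart from the absence of a walk.\<close>

lemma final_table_pos_iff:
  fixes b :: nat
  assumes G: "verts G = {..<n}" "horizon G = T" and s: "s < n" and L: "0 < L"
  defines "M \<equiv> fold (relax G n L) (schedule n L T) (initial_table n L s b)"
  shows "M (address n L T s (L - 1)) \<noteq> 0 \<longleftrightarrow>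
    (\<exists>j c. reach G s T s j c \<and> L - 1 \<le> j \<and> c \<le> b)"
proof
  have "sound_table G s n L b (initial_table n L s b)"
    unfolding sound_table_def
  proof (intro allI impI)
    fix t v j
    assume "v < n" "j < L" and pos: "initial_table n L s b (address n L t v j) > 0"
    then have "address n L t v j = address n L 1 s 0"
      by (auto simp: initial_table_def split: if_splits)
    with \<open>v < n\<close> \<open>j < L\<close> s L have "t = 1" "v = s" "j = 0" by (simp_all add: address_eq_iff)
    then show "\<exists>j' c. reach G s t v j' c \<and> j \<le> j' \<and>
        initial_table n L s b (address n L t v j) + c = Suc b"
      using reach.start[of G s]
      by (intro exI[of _ 0] exI[of _ 0]) (simp add: initial_table_def)
  qed
  then have "sound_table G s n L b M"
    unfolding M_def by (rule sound_table_fold_relax) (auto simp: set_schedule)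
  moreover assume "M (address n L T s (L - 1)) \<noteq> 0"
  ultimately obtain j c where "reach G s T s j c" "L - 1 \<le> j"
      "M (address n L T s (L - 1)) + c = Suc b"
    using s L unfolding sound_table_def by (metis diff_less neq0_conv zero_less_one)
  with \<open>M _ \<noteq> 0\<close> show "\<exists>j c. reach G s T s j c \<and> L - 1 \<le> j \<and> c \<le> b"
    by (intro exI[of _ j] exI[of _ c]) auto
next
  assume "\<exists>j c. reach G s T s j c \<and> L - 1 \<le> j \<and> c \<le> b"
  then obtain j c where "reach G s T s j c" "L - 1 \<le> j" "c \<le> b" by blast
  with final_table_ge[OF G s this(1), of "L - 1" L b] L
  have "M (address n L T s (L - 1)) \<ge> Suc b - c" by (simp add: M_def)
  with \<open>c \<le> b\<close> show "M (address n L T s (L - 1)) \<noteq> 0" by linarith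
qed


section \<open>Weakest preconditions with step bounds\<close>

text \<open>Total correctness, with \<open>k\<close> an upper bound so that branches of different
  lengths can share it.\<close>

definition wp :: "nat tcg \<Rightarrow> com \<Rightarrow> state \<Rightarrow> nat \<Rightarrow> (state \<Rightarrow> bool) \<Rightarrow> bool" where
  "wp G c \<sigma> k Q \<longleftrightarrow> (\<exists>l \<tau>. exec G c \<sigma> l \<tau> \<and> l \<le> k \<and> Q \<tau>)"

inductive_cases exec_DoE: "exec G (Do i) \<sigma> k \<tau>"
inductive_cases exec_SeqE: "exec G (Seq c\<^sub>1 c\<^sub>2) \<sigma> k \<tau>"
inductive_cases exec_IfE: "exec G (IfLess x y c\<^sub>1 c\<^sub>2) \<sigma> k \<tau>"

lemma exec_Do_iff: "exec G (Do i) \<sigma> k \<tau> \<longleftrightarrow> k = 1 \<and> \<tau> = exec_instr G i \<sigma>"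
  by (rule iffI, erule exec_DoE) (use exec.Do in auto)

lemma exec_Seq_iff:
  "exec G (Seq c\<^sub>1 c\<^sub>2) \<sigma> k \<tau> \<longleftrightarrow> (\<exists>l \<sigma>' l'. exec G c\<^sub>1 \<sigma> l \<sigma>' \<and> exec G c\<^sub>2 \<sigma>' l' \<tau> \<and> k = l + l')"
  by (blast intro: exec.Seq elim: exec_SeqE)

lemma exec_If_iff:
  "exec G (IfLess x y c\<^sub>1 c\<^sub>2) \<sigma> k \<tau> \<longleftrightarrow>
     (\<exists>l. exec G (if fst \<sigma> x < fst \<sigma> y then c\<^sub>1 else c\<^sub>2) \<sigma> l \<tau> \<and> k = Suc l)"
proof
  assume "exec G (IfLess x y c\<^sub>1 c\<^sub>2) \<sigma> k \<tau>"
  then show "\<exists>l. exec G (if fst \<sigma> x < fst \<sigma> y then c\<^sub>1 else c\<^sub>2) \<sigma> l \<tau> \<and> k = Suc l"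
    by (rule exec_IfE) auto
qed (auto intro: exec.IfTrue exec.IfFalse split: if_splits)

lemma wp_Do: "wp G (Do i) \<sigma> k Q \<longleftrightarrow> 1 \<le> k \<and> Q (exec_instr G i \<sigma>)"
  by (simp add: wp_def exec_Do_iff)

lemma wp_If:
  "wp G (IfLess x y c\<^sub>1 c\<^sub>2) \<sigma> k Q \<longleftrightarrow>
     1 \<le> k \<and> (if fst \<sigma> x < fst \<sigma> y then wp G c\<^sub>1 \<sigma> (k - 1) Q else wp G c\<^sub>2 \<sigma> (k - 1) Q)"
proof -
  have "wp G (IfLess x y c\<^sub>1 c\<^sub>2) \<sigma> k Q \<longleftrightarrow>
      1 \<le> k \<and> wp G (if fst \<sigma> x < fst \<sigma> y then c\<^sub>1 else c\<^sub>2) \<sigma> (k - 1) Q"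
    unfolding wp_def exec_If_iff by (cases k) auto
  then show ?thesis by simp
qed

lemma wp_SeqI:
  assumes "wp G c\<^sub>1 \<sigma> l (\<lambda>\<sigma>'. wp G c\<^sub>2 \<sigma>' (k - l) Q)" "l \<le> k"
  shows "wp G (Seq c\<^sub>1 c\<^sub>2) \<sigma> k Q"
proof -
  obtain l1 \<sigma>' l2 \<tau> where *: "exec G c\<^sub>1 \<sigma> l1 \<sigma>'" "l1 \<le> l" "exec G c\<^sub>2 \<sigma>' l2 \<tau>" "l2 \<le> k - l" "Q \<tau>"
    using assms(1) by (auto simp: wp_def)
  then have "l1 + l2 \<le> k" using assms(2) by simp
  with * show ?thesis unfolding wp_def by (blast intro: exec.Seq)
qed

lemma wp_Seq_Do:
  "wp G (Seq (Do i) c) \<sigma> k Q \<longleftrightarrow> 1 \<le> k \<and> wp G c (exec_instr G i \<sigma>) (k - 1) Q"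
proof -
  have "(\<exists>l \<tau>. exec G (Seq (Do i) c) \<sigma> l \<tau> \<and> l \<le> k \<and> Q \<tau>) \<longleftrightarrow>
      (\<exists>l \<tau>. exec G c (exec_instr G i \<sigma>) l \<tau> \<and> Suc l \<le> k \<and> Q \<tau>)"
    unfolding exec_Seq_iff exec_Do_iff by auto
  then show ?thesis unfolding wp_def by (cases k) auto
qed

lemma wp_Seq_assoc: "wp G (Seq (Seq c\<^sub>1 c\<^sub>2) c\<^sub>3) \<sigma> k Q \<longleftrightarrow> wp G (Seq c\<^sub>1 (Seq c\<^sub>2 c\<^sub>3)) \<sigma> k Q"
proof -
  have "exec G (Seq (Seq c\<^sub>1 c\<^sub>2) c\<^sub>3) \<sigma> k \<tau> \<longleftrightarrow> exec G (Seq c\<^sub>1 (Seq c\<^sub>2 c\<^sub>3)) \<sigma> k \<tau>" for k \<tau>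
  proof
    assume "exec G (Seq (Seq c\<^sub>1 c\<^sub>2) c\<^sub>3) \<sigma> k \<tau>"
    then obtain l\<^sub>1 \<sigma>\<^sub>1 l\<^sub>2 \<sigma>\<^sub>2 l\<^sub>3 where "exec G c\<^sub>1 \<sigma> l\<^sub>1 \<sigma>\<^sub>1" "exec G c\<^sub>2 \<sigma>\<^sub>1 l\<^sub>2 \<sigma>\<^sub>2"
      "exec G c\<^sub>3 \<sigma>\<^sub>2 l\<^sub>3 \<tau>" "k = l\<^sub>1 + (l\<^sub>2 + l\<^sub>3)"
      by (auto elim!: exec_SeqE)
    then show "exec G (Seq c\<^sub>1 (Seq c\<^sub>2 c\<^sub>3)) \<sigma> k \<tau>" by (auto intro: exec.Seq)
  next
    assume "exec G (Seq c\<^sub>1 (Seq c\<^sub>2 c\<^sub>3)) \<sigma> k \<tau>"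
    then obtain l\<^sub>1 \<sigma>\<^sub>1 l\<^sub>2 \<sigma>\<^sub>2 l\<^sub>3 where *: "exec G c\<^sub>1 \<sigma> l\<^sub>1 \<sigma>\<^sub>1" "exec G c\<^sub>2 \<sigma>\<^sub>1 l\<^sub>2 \<sigma>\<^sub>2"
      "exec G c\<^sub>3 \<sigma>\<^sub>2 l\<^sub>3 \<tau>" "k = l\<^sub>1 + l\<^sub>2 + l\<^sub>3"
      by (auto elim!: exec_SeqE)
    then show "exec G (Seq (Seq c\<^sub>1 c\<^sub>2) c\<^sub>3) \<sigma> k \<tau>" by (auto intro: exec.Seq)
  qed
  then show ?thesis by (simp add: wp_def)
qed

text \<open>Moving the continuation into both branches lets the simplifier execute code symbolically
  up to the next loop.\<close>

lemma wp_Seq_If: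
  "wp G (Seq (IfLess x y c\<^sub>1 c\<^sub>2) c) \<sigma> k Q \<longleftrightarrow>
     1 \<le> k \<and> (if fst \<sigma> x < fst \<sigma> y then wp G (Seq c\<^sub>1 c) \<sigma> (k - 1) Q
       else wp G (Seq c\<^sub>2 c) \<sigma> (k - 1) Q)"
proof -
  have "exec G (Seq (IfLess x y c\<^sub>1 c\<^sub>2) c) \<sigma> k \<tau> \<longleftrightarrow>
      exec G (IfLess x y (Seq c\<^sub>1 c) (Seq c\<^sub>2 c)) \<sigma> k \<tau>" for k \<tau>
    unfolding exec_Seq_iff exec_If_iff by (auto simp: exec_Seq_iff; metis add_Suc)
  then show ?thesis unfolding wp_If[symmetric] by (simp add: wp_def)
qed

lemmas wp_simps = wp_Do wp_If wp_Seq_Do wp_Seq_assoc wp_Seq_If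

lemma wp_mono:
  "wp G c \<sigma> k Q \<Longrightarrow> k \<le> k' \<Longrightarrow> (\<And>\<tau>. Q \<tau> \<Longrightarrow> Q' \<tau>) \<Longrightarrow> wp G c \<sigma> k' Q'"
  unfolding wp_def by (blast intro: order_trans)

text \<open>\<open>B + 1\<close> counts the body and its successful test; the last 1 is the failing
  test.\<close>

lemma wp_for:
  assumes vals: "\<And>i \<sigma>. Inv i \<sigma> \<Longrightarrow> fst \<sigma> x = i \<and> fst \<sigma> y = N"
    and body: "\<And>i \<sigma>. Inv i \<sigma> \<Longrightarrow> a \<le> i \<Longrightarrow> i < N \<Longrightarrow> wp G c \<sigma> B (Inv (Suc i))"
    and init: "Inv a \<sigma>" "a \<le> N" and k: "(N - a) * (B + 1) + 1 \<le> k"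
  shows "wp G (WhileLess x y c) \<sigma> k (Inv N)"
proof -
  have "wp G (WhileLess x y c) \<sigma> (d * Suc B + 1) (Inv N)" if "Inv i \<sigma>" "a \<le> i" "i + d = N" for i d \<sigma>
    using that
  proof (induction d arbitrary: i \<sigma>)
    case 0
    then have "\<not> fst \<sigma> x < fst \<sigma> y" using vals[of i \<sigma>] by simp
    note exec.WhileFalse[OF this, of G c]
    moreover have "Inv N \<sigma>" using 0 by simp
    ultimately show ?case unfolding wp_def by (intro exI conjI) auto
  next
    case (Suc d)
    then have less: "fst \<sigma> x < fst \<sigma> y" using vals[of i \<sigma>] by simp
    obtain l \<sigma>' where 1: "exec G c \<sigma> l \<sigma>'" "l \<le> B" "Inv (Suc i) \<sigma>'"
      using body[of i \<sigma>] Suc.prems by (auto simp: wp_def)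
    obtain l' \<tau> where 2: "exec G (WhileLess x y c) \<sigma>' l' \<tau>" "l' \<le> d * Suc B + 1" "Inv N \<tau>"
      using Suc.IH[OF 1(3)] Suc.prems by (auto simp: wp_def)
    have "Suc (l + l') \<le> Suc d * Suc B + 1" using 1(2) 2(2) by simp
    then show ?case
      unfolding wp_def using exec.WhileTrue[OF less 1(1) 2(1)] 2(3) by blast
  qed
  from this[of a \<sigma> "N - a"] show ?thesis using init k by (auto intro: wp_mono)
qed

text \<open>\<open>J\<close> speaks of registers only; the memory is determined completely as a
  functional fold, so nested loops become nested folds.\<close>

lemma wp_for_fold:
  assumes vals: "\<And>i r. J i r \<Longrightarrow> r x = i \<and> r y = N"
    and body: "\<And>i r m. J i r \<Longrightarrow> a \<le> i \<Longrightarrow> i < N \<Longrightarrow>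
      wp G c (r, m) B (\<lambda>(r', m'). J (Suc i) r' \<and> m' = f i m)"
    and init: "J a r" "a \<le> N" and k: "(N - a) * (B + 1) + 1 \<le> k"
  shows "wp G (WhileLess x y c) (r, m) k (\<lambda>(r', m'). J N r' \<and> m' = fold f [a..<N] m)"
proof -
  define Inv where "Inv i \<sigma> \<longleftrightarrow> a \<le> i \<and> J i (fst \<sigma>) \<and> snd \<sigma> = fold f [a..<i] m" for i and \<sigma> :: state
  have "wp G (WhileLess x y c) (r, m) k (Inv N)"
  proof (rule wp_for[OF _ _ _ init(2) k])
    show "fst \<sigma> x = i \<and> fst \<sigma> y = N" if "Inv i \<sigma>" for i \<sigma>
      using vals[of i "fst \<sigma>"] that by (simp add: Inv_def)
    show "wp G c \<sigma> B (Inv (Suc i))" if "Inv i \<sigma>" "a \<le> i" "i < N" for i \<sigma>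
      using body[of i "fst \<sigma>" "snd \<sigma>"] that
      by (auto simp: Inv_def intro: wp_mono)
    show "Inv a (r, m)" using init by (simp add: Inv_def)
  qed
  then show ?thesis by (rule wp_mono) (auto simp: Inv_def)
qed


section \<open>The program\<close>

fun seqs :: "com list \<Rightarrow> com" where
  "seqs [] = Do (Const 28 0)"
| "seqs [c] = c"
| "seqs (c # cs) = Seq c (seqs cs)"

text \<open>Registers 11, 13, 15, 17, 22 are the loop counters for arrival time, departure time, target,
  origin and number of moves; 12, 14, 16, 18 hold the matching partial addresses, which
  avoids multiplication. Register 8 is never written, so it is the constant 0, and register 9 is
  the constant 1. A cost code is the cost plus 1, hence the subtraction of register 9 from 21.\<close>

definition relax_code :: com where
  "relax_code = seqs
     [Do (Sub 23 22 19), Do (Add 23 23 18), Do (Load 25 23), Do (Sub 25 25 21),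
      Do (Add 24 22 16), Do (Load 26 24),
      IfLess 26 25 (Do (Store 24 25)) (Do (Const 26 0)),
      Do (Add 22 22 9)]"

text \<open>Register 20 flags an admissible pair and register 19 is the number of moves the step
  counts for, 0 when waiting. Cost code 0 means infinite cost, so the second test against register 8
  discards it.\<close>

definition edge_code :: com where
  "edge_code = seqs
     [Do (Const 19 1),
      IfLess 15 17 (Do (Adjacent 20 17 15))
        (IfLess 17 15 (Do (Adjacent 20 17 15)) (seqs [Do (Const 20 1), Do (Const 19 0)])),
      Do (Cost 21 17 15 13 11),
      IfLess 8 20
        (IfLess 8 21 (seqs [Do (Sub 21 21 9), Do (Const 22 0), WhileLess 22 6 relax_code])
          (Do (Const 20 0)))
        (Do (Const 20 0)),
      Do (Add 17 17 9), Do (Add 18 18 6)]"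

definition target_code :: com where
  "target_code = seqs
     [Do (Const 17 0), Do (Add 18 14 8), WhileLess 17 0 edge_code,
      Do (Add 15 15 9), Do (Add 16 16 6)]"

definition departure_code :: com where
  "departure_code = seqs
     [Do (Const 15 0), Do (Add 16 12 8), WhileLess 15 0 target_code,
      Do (Add 13 13 9), Do (Add 14 14 7)]"

definition arrival_code :: com where
  "arrival_code = seqs
     [Do (Const 13 1), Do (Add 14 7 8), WhileLess 13 11 departure_code,
      Do (Add 11 11 9), Do (Add 12 12 7)]"

text \<open>The two short loops compute \<open>n * L\<close> and \<open>s * L\<close> for
  \<open>L = 2 k - 1\<close>, whose layers are numbered from 0 to \<open>2 (k - 1)\<close>. Their
  sum is the address of the start cell, since its time is 1.\<close>

definition table_code :: com where
  "table_code = seqs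
     [Do (Const 9 1), Do (Add 6 4 4), Do (Sub 6 6 9), Do (Add 10 1 9),
      Do (Const 15 0), WhileLess 15 0 (seqs [Do (Add 15 15 9), Do (Add 7 7 6)]),
      Do (Const 15 0), WhileLess 15 2 (seqs [Do (Add 15 15 9), Do (Add 27 27 6)]),
      Do (Add 16 7 27), Do (Add 25 5 9), Do (Store 16 25),
      Do (Const 11 1), Do (Add 12 7 8), WhileLess 11 10 arrival_code,
      Do (Sub 23 12 7), Do (Add 23 23 27), Do (Add 23 23 6), Do (Sub 23 23 9), Do (Load 0 23)]"

text \<open>Quota 0 is separate: only constant time is allowed there, and \<open>2 k - 1\<close>
  would truncate to an empty range of layers.\<close>

definition ccto_code :: com where
  "ccto_code = IfLess 8 4 table_code (Do (Const 0 1))"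

section \<open>Correctness and step counts of the nested loops\<close>

lemma cost_code_pos_iff: "0 < cost_code c \<longleftrightarrow> c < \<infinity>"
  by (cases c) auto

lemma cost_code_minus_1: "c < \<infinity> \<Longrightarrow> cost_code c - Suc 0 = the_enat c"
  by (cases c) auto

lemma fold_concat_map: "fold f (concat (map g xs)) m = fold (\<lambda>x. fold f (g x)) xs m"
  by (induction xs arbitrary: m) auto

locale table =
  fixes G :: "nat tcg" and n T s L :: nat
  assumes G: "temporal_cost_graph G" "verts G = {..<n}" "horizon G = T"
begin

text \<open>There is one register predicate per loop level, each extending the enclosing one. Inner
  loops are thus free to overwrite registers that the outer levels do not mention.\<close>

definition regs_global :: "(nat \<Rightarrow> nat) \<Rightarrow> bool" where
  "regs_global r \<longleftrightarrow> r 0 = n \<and> r 6 = L \<and> r 7 = n * L \<and> r 8 = 0 \<and> r 9 = 1 \<and> r 10 = Suc T \<and> r 27 = s * L"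

definition regs_arrival :: "nat \<Rightarrow> (nat \<Rightarrow> nat) \<Rightarrow> bool" where
  "regs_arrival t' r \<longleftrightarrow> regs_global r \<and> r 11 = t' \<and> r 12 = t' * (n * L)"

definition regs_departure :: "nat \<Rightarrow> nat \<Rightarrow> (nat \<Rightarrow> nat) \<Rightarrow> bool" where
  "regs_departure t' t r \<longleftrightarrow> regs_arrival t' r \<and> r 13 = t \<and> r 14 = t * (n * L)"

definition regs_target :: "nat \<Rightarrow> nat \<Rightarrow> nat \<Rightarrow> (nat \<Rightarrow> nat) \<Rightarrow> bool" where
  "regs_target t' t v r \<longleftrightarrow> regs_departure t' t r \<and> r 15 = v \<and> r 16 = t' * (n * L) + v * L"

definition regs_edge :: "nat \<Rightarrow> nat \<Rightarrow> nat \<Rightarrow> nat \<Rightarrow> (nat \<Rightarrow> nat) \<Rightarrow> bool" where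
  "regs_edge t' t v u r \<longleftrightarrow> regs_target t' t v r \<and> r 17 = u \<and> r 18 = t * (n * L) + u * L"

definition regs_relax :: "nat \<Rightarrow> nat \<Rightarrow> nat \<Rightarrow> nat \<Rightarrow> nat \<Rightarrow> (nat \<Rightarrow> nat) \<Rightarrow> bool" where
  "regs_relax t' t v u j r \<longleftrightarrow> regs_edge t' t v u r \<and> r 19 = (if u = v then 0 else 1) \<and>
     r 21 = the_enat (cost G u v t t') \<and> r 22 = j"

lemmas regs_defs = regs_global_def regs_arrival_def regs_departure_def regs_target_def
  regs_edge_def regs_relax_def

lemma wp_relax_code:
  assumes "regs_relax t' t v u j r" "valid_step G (u, v, t, t')"
  shows "wp G relax_code (r, m) 9
    (\<lambda>(r', m'). regs_relax t' t v u (Suc j) r' \<and> m' = relax G n L (t', t, v, u, j) m)"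
proof -
  have dst: "j + r 16 = address n L t' v j"
    and src: "j - r 19 + r 18 = address n L t u (if u = v then j else j - 1)"
    using assms(1) by (simp_all add: regs_defs address_def)
  have regs: "r 9 = 1" "r 21 = the_enat (cost G u v t t')" "r 22 = j"
    using assms(1) by (simp_all add: regs_defs)
  let ?x = "m (address n L t u (if u = v then j else j - 1)) - the_enat (cost G u v t t')"
  \<comment> \<open>Storing only on strict improvement has the same effect as the update by
    \<open>max\<close>.\<close>
  have relax: "relax G n L (t', t, v, u, j) m =
      (if m (address n L t' v j) < ?x then m(address n L t' v j := ?x) else m)"
    using assms(2) by (auto simp: relax_def max_def)
  show ?thesis
    unfolding relax
    apply (simp add: relax_code_def wp_simps regs dst src del: One_nat_def)
    using assms(1) by (simp add: regs_defs)
qed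

definition relax_edge :: "nat \<Rightarrow> nat \<Rightarrow> nat \<Rightarrow> nat \<Rightarrow> (nat \<Rightarrow> nat) \<Rightarrow> nat \<Rightarrow> nat" where
  "relax_edge t' t v u = fold (\<lambda>j. relax G n L (t', t, v, u, j)) [0..<L]"

lemma wp_relax_loop:
  assumes "regs_relax t' t v u 0 r" "valid_step G (u, v, t, t')"
  shows "wp G (WhileLess 22 6 relax_code) (r, m) (L * 10 + 1)
    (\<lambda>(r', m'). regs_edge t' t v u r' \<and> m' = relax_edge t' t v u m)"
proof -
  have "wp G (WhileLess 22 6 relax_code) (r, m) (L * 10 + 1)
    (\<lambda>(r', m'). regs_relax t' t v u L r' \<and> m' = fold (\<lambda>j. relax G n L (t', t, v, u, j)) [0..<L] m)"
  proof (rule wp_for_fold[where J = "regs_relax t' t v u" and B = "9"])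
    show "r' 22 = j \<and> r' 6 = L" if "regs_relax t' t v u j r'" for j r'
      using that by (simp add: regs_defs)
  qed (use assms in \<open>simp_all add: wp_relax_code\<close>)
  then show ?thesis by (rule wp_mono) (auto simp: relax_edge_def regs_relax_def)
qed

lemma relax_edge_invalid:
  assumes "\<not> valid_step G (u, v, t, t')"
  shows "relax_edge t' t v u m = m"
proof -
  have "relax G n L (t', t, v, u, j) = id" for j using assms by (auto simp: relax_def)
  then have "fold (\<lambda>j. relax G n L (t', t, v, u, j)) js m = m" for js by (induction js) auto
  then show ?thesis by (simp add: relax_edge_def)
qed

lemma wp_edge_code:
  assumes r: "regs_edge t' t v u r"
    and bounds: "1 \<le> t" "t < t'" "t' \<le> T" "v < n" "u < n"
  shows "wp G edge_code (r, m) (L * 10 + 14)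
    (\<lambda>(r', m'). regs_edge t' t v (Suc u) r' \<and> m' = relax_edge t' t v u m)"
proof -
  have no_loop: "{u} \<notin> edges G"
    using G(1) by (auto simp: temporal_cost_graph_def simple_graph_def)
  let ?loop = "seqs [WhileLess 22 6 relax_code, Do (Add 17 17 9), Do (Add 18 18 6)]"
  have loop: "wp G ?loop (r', m) k
    (\<lambda>(r', m'). regs_edge t' t v (Suc u) r' \<and> m' = relax_edge t' t v u m)"
    if "regs_relax t' t v u 0 r'" "valid_step G (u, v, t, t')" "L * 10 + 3 \<le> k" for r' k
    unfolding seqs.simps
  proof (rule wp_SeqI[OF wp_mono[OF wp_relax_loop[OF that(1,2)] order_refl]])
    show "case \<tau> of (r', m') \<Rightarrow> regs_edge t' t v u r' \<and> m' = relax_edge t' t v u m \<Longrightarrow>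
      wp G (Seq (Do (Add 17 17 9)) (Do (Add 18 18 6))) \<tau> (k - (L * 10 + 1))
        (\<lambda>(r', m'). regs_edge t' t v (Suc u) r' \<and> m' = relax_edge t' t v u m)" for \<tau>
      using that(3) by (auto simp: wp_simps regs_defs)
  qed (use that(3) in simp)
  \<comment> \<open>Within the loop bounds, validity reduces to the two conditions that the program
    tests.\<close>
  have valid: "valid_step G (u, v, t, t') \<longleftrightarrow> (u = v \<or> {u, v} \<in> edges G) \<and> cost G u v t t' < \<infinity>"
    using bounds G by (auto simp: valid_step_def)
  have regs: "r 8 = 0" "r 9 = 1" "r 11 = t'" "r 13 = t" "r 15 = v" "r 17 = u"
    using r by (simp_all add: regs_defs)
  note code = edge_code_def wp_simps regs cost_code_pos_iff
  show ?thesis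
  proof (cases "valid_step G (u, v, t, t')")
    case True
    then have cost: "cost G u v t t' < \<infinity>" and adj: "u \<noteq> v \<Longrightarrow> {u, v} \<in> edges G"
      using valid by auto
    show ?thesis
    proof (cases u v rule: linorder_cases)
      case less
      then show ?thesis
        using cost adj by (simp add: code, intro loop[unfolded seqs.simps] True)
          (use r cost in \<open>simp_all add: regs_defs cost_code_minus_1\<close>)
    next
      case equal
      then show ?thesis
        using cost by (simp add: code, intro loop[unfolded seqs.simps equal] True[unfolded equal])
          (use r cost equal in \<open>simp_all add: regs_defs cost_code_minus_1\<close>)
    next
      case greater
      then show ?thesis
        using cost adj by (simp add: code, intro loop[unfolded seqs.simps] True)
          (use r cost in \<open>simp_all add: regs_defs cost_code_minus_1\<close>)
    qed
  next
    case False
    then have "u \<noteq> v \<and> {u, v} \<notin> edges G \<or> cost G u v t t' = \<infinity>"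
      using valid by auto
    moreover have "regs_edge t' t v (Suc u) r'"
      if "r' 17 = Suc u" "r' 18 = t * (n * L) + Suc u * L" "\<And>x. x < 17 \<Longrightarrow> r' x = r x" "r' 27 = r 27" for r'
      using r that by (simp add: regs_defs)
    moreover have "r 18 = t * (n * L) + u * L" "r 6 = L" using r by (simp_all add: regs_defs)
    ultimately show ?thesis
      using False by (auto simp: code relax_edge_invalid)
  qed
qed

definition relax_target :: "nat \<Rightarrow> nat \<Rightarrow> nat \<Rightarrow> (nat \<Rightarrow> nat) \<Rightarrow> nat \<Rightarrow> nat" where
  "relax_target t' t v = fold (relax_edge t' t v) [0..<n]"

text \<open>The 15 is the constant of the edge code plus a loop test; the 5 is the failing test and
  four bookkeeping instructions. The enclosing levels repeat this pattern.\<close>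

lemma wp_target_code:
  assumes r: "regs_target t' t v r" and bounds: "1 \<le> t" "t < t'" "t' \<le> T" "v < n"
  shows "wp G target_code (r, m) (n * (L * 10 + 15) + 5)
    (\<lambda>(r', m'). regs_target t' t (Suc v) r' \<and> m' = relax_target t' t v m)"
proof -
  have loop: "wp G (WhileLess 17 0 edge_code) (r', m) (n * (L * 10 + 15) + 1)
    (\<lambda>(r', m'). regs_edge t' t v n r' \<and> m' = fold (relax_edge t' t v) [0..<n] m)"
    if "regs_edge t' t v 0 r'" for r'
  proof (rule wp_for_fold[where J = "regs_edge t' t v" and B = "L * 10 + 14"])
    show "r'' 17 = u \<and> r'' 0 = n" if "regs_edge t' t v u r''" for u r''
      using that by (simp add: regs_defs)
  qed (use that bounds in \<open>simp_all add: wp_edge_code\<close>)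
  have rest: "wp G (seqs [WhileLess 17 0 edge_code, Do (Add 15 15 9), Do (Add 16 16 6)]) (r', m) k
    (\<lambda>(r', m'). regs_target t' t (Suc v) r' \<and> m' = relax_target t' t v m)"
    if "regs_edge t' t v 0 r'" "n * (L * 10 + 15) + 3 \<le> k" for r' k
    unfolding seqs.simps
    by (rule wp_SeqI[OF wp_mono[OF loop[OF that(1)] order_refl]])
      (use that(2) in \<open>auto simp: wp_simps regs_defs relax_target_def\<close>)
  show ?thesis
    by (simp add: target_code_def wp_simps, rule rest[unfolded seqs.simps])
      (use r in \<open>simp_all add: regs_defs\<close>)
qed

definition relax_departure :: "nat \<Rightarrow> nat \<Rightarrow> (nat \<Rightarrow> nat) \<Rightarrow> nat \<Rightarrow> nat" where
  "relax_departure t' t = fold (relax_target t' t) [0..<n]"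

lemma wp_departure_code:
  assumes r: "regs_departure t' t r" and bounds: "1 \<le> t" "t < t'" "t' \<le> T"
  shows "wp G departure_code (r, m) (n * (n * (L * 10 + 15) + 6) + 5)
    (\<lambda>(r', m'). regs_departure t' (Suc t) r' \<and> m' = relax_departure t' t m)"
proof -
  have loop: "wp G (WhileLess 15 0 target_code) (r', m) (n * (n * (L * 10 + 15) + 6) + 1)
    (\<lambda>(r', m'). regs_target t' t n r' \<and> m' = fold (relax_target t' t) [0..<n] m)"
    if "regs_target t' t 0 r'" for r'
  proof (rule wp_for_fold[where J = "regs_target t' t" and B = "n * (L * 10 + 15) + 5"])
    show "r'' 15 = v \<and> r'' 0 = n" if "regs_target t' t v r''" for v r''
      using that by (simp add: regs_defs)
  qed (use that bounds in \<open>simp_all add: wp_target_code\<close>)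
  have rest: "wp G (seqs [WhileLess 15 0 target_code, Do (Add 13 13 9), Do (Add 14 14 7)]) (r', m) k
    (\<lambda>(r', m'). regs_departure t' (Suc t) r' \<and> m' = relax_departure t' t m)"
    if "regs_target t' t 0 r'" "n * (n * (L * 10 + 15) + 6) + 3 \<le> k" for r' k
    unfolding seqs.simps
    by (rule wp_SeqI[OF wp_mono[OF loop[OF that(1)] order_refl]])
      (use that(2) in \<open>auto simp: wp_simps regs_defs relax_departure_def\<close>)
  show ?thesis
    by (simp add: departure_code_def wp_simps, rule rest[unfolded seqs.simps])
      (use r in \<open>simp_all add: regs_defs\<close>)
qed

definition relax_arrival :: "nat \<Rightarrow> (nat \<Rightarrow> nat) \<Rightarrow> nat \<Rightarrow> nat" where
  "relax_arrival t' = fold (relax_departure t') [1..<t']"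

lemma wp_arrival_code:
  assumes r: "regs_arrival t' r" and bounds: "1 \<le> t'" "t' \<le> T"
  shows "wp G arrival_code (r, m) (T * (n * (n * (L * 10 + 15) + 6) + 6) + 5)
    (\<lambda>(r', m'). regs_arrival (Suc t') r' \<and> m' = relax_arrival t' m)"
proof -
  have loop: "wp G (WhileLess 13 11 departure_code) (r', m) (T * (n * (n * (L * 10 + 15) + 6) + 6) + 1)
    (\<lambda>(r', m'). regs_departure t' t' r' \<and> m' = fold (relax_departure t') [1..<t'] m)"
    if "regs_departure t' 1 r'" for r'
  proof (rule wp_for_fold[where J = "regs_departure t'" and B = "n * (n * (L * 10 + 15) + 6) + 5"])
    show "r'' 13 = t \<and> r'' 11 = t'" if "regs_departure t' t r''" for t r''
      using that by (simp add: regs_defs)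
    \<comment> \<open>The loop makes \<open>t' - 1\<close> rounds; replacing this by
      \<open>T\<close> gives all arrival times the same bound.\<close>
    have "(t' - 1) * (n * (n * (L * 10 + 15) + 6) + 5 + 1) \<le> T * (n * (n * (L * 10 + 15) + 6) + 6)"
      by (rule mult_le_mono) (use bounds in simp_all)
    then show "(t' - 1) * (n * (n * (L * 10 + 15) + 6) + 5 + 1) + 1
        \<le> T * (n * (n * (L * 10 + 15) + 6) + 6) + 1"
      by simp
  qed (use that bounds in \<open>simp_all add: wp_departure_code\<close>)
  have rest: "wp G (seqs [WhileLess 13 11 departure_code, Do (Add 11 11 9), Do (Add 12 12 7)]) (r', m) k
    (\<lambda>(r', m'). regs_arrival (Suc t') r' \<and> m' = relax_arrival t' m)"
    if "regs_departure t' 1 r'" "T * (n * (n * (L * 10 + 15) + 6) + 6) + 3 \<le> k" for r' k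
    unfolding seqs.simps
    by (rule wp_SeqI[OF wp_mono[OF loop[OF that(1)] order_refl]])
      (use that(2) in \<open>auto simp: wp_simps regs_defs relax_arrival_def\<close>)
  show ?thesis
    by (simp add: arrival_code_def wp_simps, rule rest[unfolded seqs.simps])
      (use r in \<open>simp_all add: regs_defs\<close>)
qed

lemma fold_relax_arrival:
  "fold relax_arrival [1..<Suc T] m = fold (relax G n L) (schedule n L T) m"
  unfolding schedule_def relax_arrival_def relax_departure_def relax_target_def relax_edge_def
    fold_concat_map fold_map comp_def
  by (rule refl)

lemma wp_arrival_loop:
  assumes "regs_arrival 1 r"
  shows "wp G (WhileLess 11 10 arrival_code) (r, m)
      (T * (T * (n * (n * (L * 10 + 15) + 6) + 6) + 6) + 1)
    (\<lambda>(r', m'). regs_arrival (Suc T) r' \<and> m' = fold (relax G n L) (schedule n L T) m)"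
proof -
  have "wp G (WhileLess 11 10 arrival_code) (r, m)
      (T * (T * (n * (n * (L * 10 + 15) + 6) + 6) + 6) + 1)
    (\<lambda>(r', m'). regs_arrival (Suc T) r' \<and> m' = fold relax_arrival [1..<Suc T] m)"
  proof (rule wp_for_fold[where J = "regs_arrival" and B = "T * (n * (n * (L * 10 + 15) + 6) + 6) + 5"])
    show "r'' 11 = t' \<and> r'' 10 = Suc T" if "regs_arrival t' r''" for t' r''
      using that by (simp add: regs_defs)
  qed (use assms in \<open>simp_all add: wp_arrival_code\<close>)
  then show ?thesis unfolding fold_relax_arrival by (rule wp_mono) auto
qed

text \<open>Multiplication by repeated addition: each round is a test and two additions. The side
  conditions on registers exclude aliasing.\<close>

lemma wp_stride_loop:
  assumes "x \<notin> {y, a, 6, 9}" "a \<notin> {y, 6, 9}" "r x = 0" "r a = 0" "r 9 = 1" "r 6 = L"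
    and rest: "wp G c (r(x := r y, a := r y * L), m) l Q" and k: "r y * 3 + 1 + l \<le> k"
  shows "wp G (Seq (WhileLess x y (Seq (Do (Add x x 9)) (Do (Add a a 6)))) c) (r, m) k Q"
proof -
  have loop: "wp G (WhileLess x y (Seq (Do (Add x x 9)) (Do (Add a a 6)))) (r, m) (r y * 3 + 1)
    ((\<lambda>i \<sigma>. \<sigma> = (r(x := i, a := i * L), m)) (r y))"
    by (rule wp_for[where a = 0 and B = 2])
      (use assms in \<open>auto simp: wp_simps fun_eq_iff\<close>)
  have rest': "wp G c (r(x := r y, a := r y * L), m) (k - (r y * 3 + 1)) Q"
    by (rule wp_mono[OF rest]) (use k in auto)
  show ?thesis
    by (rule wp_SeqI[OF wp_mono[OF loop order_refl]]) (use rest' k in auto)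
qed

lemma wp_table_code:
  assumes L: "L = 2 * k - 1" "0 < k"
    and r: "r 0 = n" "r 1 = T" "r 2 = s" "r 4 = k" "r 5 = b" "\<And>x. 5 < x \<Longrightarrow> r x = 0"
  shows "wp G table_code (r, \<lambda>_. 0)
    (n * 3 + s * 3 + T * (T * (n * (n * (L * 10 + 15) + 6) + 6) + 6) + 30)
    (\<lambda>\<sigma>. fst \<sigma> 0 =
      fold (relax G n L) (schedule n L T) (initial_table n L s b) (address n L T s (L - 1)))"
proof -
  let ?M = "fold (relax G n L) (schedule n L T) (initial_table n L s b)"
  let ?Q = "\<lambda>\<sigma>::state. fst \<sigma> 0 = ?M (address n L T s (L - 1))"
  define B where "B = T * (T * (n * (n * (L * 10 + 15) + 6) + 6) + 6)"
  have L_pos: "0 < L" using L by simp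
  have main: "wp G (seqs [WhileLess 11 10 arrival_code, Do (Sub 23 12 7), Do (Add 23 23 27),
      Do (Add 23 23 6), Do (Sub 23 23 9), Do (Load 0 23)]) (r', initial_table n L s b) l ?Q"
    if "regs_arrival 1 r'" "B + 6 \<le> l" for r' l
    unfolding seqs.simps
  proof (rule wp_SeqI[OF wp_mono[OF wp_arrival_loop[OF that(1)] order_refl]])
    fix \<tau>
    assume "case \<tau> of (r', m') \<Rightarrow> regs_arrival (Suc T) r' \<and> m' = ?M"
    then obtain r' where \<tau>: "\<tau> = (r', ?M)" and r': "regs_arrival (Suc T) r'"
      by (cases \<tau>) auto
    \<comment> \<open>On exit register 12 is one row past time \<open>T\<close>, hence the
      subtraction of one row. \<open>0 < L\<close> makes the final decrement exact.\<close>
    have final: "r' 12 - r' 7 + r' 27 + r' 6 - r' 9 = address n L T s (L - 1)"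
      using r' L_pos by (simp add: regs_defs address_def)
    have "wp G (Seq (Do (Sub 23 12 7)) (Seq (Do (Add 23 23 27)) (Seq (Do (Add 23 23 6))
       (Seq (Do (Sub 23 23 9)) (Do (Load 0 23)))))) \<tau> l' ?Q" if "5 \<le> l'" for l'
      using that final by (auto simp: wp_simps \<tau>)
    then show "wp G (Seq (Do (Sub 23 12 7)) (Seq (Do (Add 23 23 27)) (Seq (Do (Add 23 23 6))
       (Seq (Do (Sub 23 23 9)) (Do (Load 0 23)))))) \<tau>
       (l - (T * (T * (n * (n * (L * 10 + 15) + 6) + 6) + 6) + 1)) ?Q"
      using that(2) by (simp add: B_def)
  qed (use that(2) in \<open>simp add: B_def\<close>)
  have start: "(\<lambda>_. 0)(n * L + s * L := b + 1) = initial_table n L s b"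
    by (simp add: initial_table_def address_def)
  have k2: "k + k - 1 = L" using L by simp
  show ?thesis
    unfolding B_def[symmetric] table_code_def seqs.simps
    apply (simp add: wp_simps r k2 del: One_nat_def)
    \<comment> \<open>The value of \<open>l\<close> covers what remains: \<open>3 s + 1\<close>
      steps for the second product, \<open>B + 1\<close> for the arrival loop, and straight-line
      code, with slack.\<close>
    apply (rule wp_stride_loop[where l = "s * 3 + B + 15"])
    apply (simp_all add: r)[6]
    apply (simp_all add: wp_simps r del: One_nat_def)
    apply (rule wp_stride_loop[where l = "B + 12"])
    apply (simp_all add: r)[6]
    apply (simp_all add: wp_simps r start del: One_nat_def)
    apply (rule main[unfolded seqs.simps])
    apply (simp_all add: regs_defs r)
    done
qed

end

text \<open>Each loop level multiplies by \<open>n\<close> or \<open>T\<close> and adds 6, which is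
  absorbed as 6 copies of a monomial that is at least 1: the coefficients run 35, 41, 47, 53, 59.
  The remaining terms cost at most 37 more copies of \<open>n^2 T^2 k\<close>, and a further factor
  \<open>k\<close> gives the square.\<close>

lemma dp_time_le:
  fixes n T k :: nat
  assumes "0 < n" "0 < T" "0 < k" "s < n" "L = 2 * k - 1"
  shows "n * 3 + s * 3 + T * (T * (n * (n * (L * 10 + 15) + 6) + 6) + 6) + 31 \<le> 100 * (n * T * k) ^ 2"
proof -
  have pos: "1 \<le> n * k" "1 \<le> n * (n * k)" "1 \<le> T * (n * (n * k))" "1 \<le> T * (T * (n * (n * k)))"
    using assms by (simp_all add: Suc_le_eq)
  have step: "p * a + 6 \<le> d * (p * q)" if "a \<le> c * q" "1 \<le> p * q" "d = c + 6" for p q a c d :: nat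
  proof -
    have "p * a \<le> c * (p * q)" using mult_le_mono2[OF that(1), of p] by (simp add: ac_simps)
    with that(2) show ?thesis unfolding that(3) add_mult_distrib by linarith
  qed
  have "L * 10 + 15 \<le> 35 * k" using assms by simp
  from step[OF this pos(1)] have "n * (L * 10 + 15) + 6 \<le> 41 * (n * k)" by simp
  from step[OF this pos(2)] have "n * (n * (L * 10 + 15) + 6) + 6 \<le> 47 * (n * (n * k))" by simp
  from step[OF this pos(3)]
  have *: "T * (n * (n * (L * 10 + 15) + 6) + 6) + 6 \<le> 53 * (T * (n * (n * k)))" by simp
  have 1: "T * (T * (n * (n * (L * 10 + 15) + 6) + 6) + 6) \<le> 59 * (T * (T * (n * (n * k))))"
    by (rule add_leD1[OF step[OF * pos(4)]]) simp
  have "n * 1 \<le> n * (T * (T * (n * k)))"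
    by (rule mult_le_mono2) (use assms in \<open>simp add: Suc_le_eq\<close>)
  then have 2: "n \<le> T * (T * (n * (n * k)))" by (simp add: ac_simps)
  have "T * (T * (n * (n * k))) * 1 \<le> T * (T * (n * (n * k))) * k"
    by (rule mult_le_mono2) (use assms in simp)
  also have "\<dots> = (n * T * k) ^ 2" by (simp add: power2_eq_square ac_simps)
  finally have 3: "T * (T * (n * (n * k))) * 1 \<le> (n * T * k)\<^sup>2" .
  have "n * 3 + s * 3 + x + 31 \<le> 100 * q" if "x \<le> 59 * p" "n \<le> p" "p * 1 \<le> q" for x p q
    using that \<open>s < n\<close> by linarith
  from this[OF 1 2 3] show ?thesis .
qed

theorem theorem1:
  "ccto_solvable_in_time
     (\<lambda>I. tree (verts (graph I)) (edges (graph I)) \<and>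
          source I = sink I \<and>
          is_lifetime (graph I) (horizon (graph I)) \<and>
          (\<forall>u v. {u, v} \<in> edges (graph I) \<longrightarrow> max_traversal_number (graph I) u v \<le> 3))
     (\<lambda>I. (card (verts (graph I)) * horizon (graph I) * quota I) ^ 2)"
  unfolding ccto_solvable_in_time_def
proof (rule exI[of _ ccto_code], rule exI[of _ 100], intro allI impI, elim conjE)
  fix I :: "nat ccto"
  assume I: "ccto_instance I" and V: "verts (graph I) = {..<card (verts (graph I))}"
    and tree: "tree (verts (graph I)) (edges (graph I))" and closed: "source I = sink I"
    and lifetime: "is_lifetime (graph I) (horizon (graph I))"
    and trav: "\<forall>u v. {u, v} \<in> edges (graph I) \<longrightarrow> max_traversal_number (graph I) u v \<le> 3"
  define n where "n = card (verts (graph I))"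
  define T where "T = horizon (graph I)"
  define L where "L = 2 * quota I - 1"
  let ?bound = "100 * max 1 ((n * T * quota I) ^ 2)"
  have acyclic: "\<nexists>xs. graph_cycle (edges (graph I)) xs" using tree by (simp add: tree_def)
  have G: "temporal_cost_graph (graph I)" "verts (graph I) = {..<n}" "horizon (graph I) = T"
    and s: "source I < n"
    using I V by (auto simp: ccto_instance_def n_def T_def)
  have T: "0 < T" using lifetime by (auto simp: is_lifetime_def Let_def T_def)
  interpret table "graph I" n T "source I" L by standard (rule G)+
  note yes_iff = ccto_yes_iff_reach[OF I closed lifetime acyclic trav]
  have "wp (graph I) ccto_code (initial_state I) ?bound (\<lambda>\<tau>. accepting \<tau> \<longleftrightarrow> ccto_yes I)"
  proof (cases "quota I = 0")
    case True
    \<comment> \<open>For quota 0, waiting at the source until the horizon is a solution for every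
      budget.\<close>
    have "reach (graph I) (source I) T (source I) 0 0"
      by (rule reach_wait[OF reach.start G(1)]) (use s T G in auto)
    then have "ccto_yes I" unfolding yes_iff using True by (auto simp: G)
    then show ?thesis
      using True by (simp add: ccto_code_def wp_simps initial_state_def accepting_def)
  next
    case False
    let ?r = "fst (initial_state I)"
    let ?k = "n * 3 + source I * 3 + T * (T * (n * (n * (L * 10 + 15) + 6) + 6) + 6) + 30"
    have code: "wp (graph I) table_code (?r, \<lambda>_. 0) ?k (\<lambda>\<sigma>. fst \<sigma> 0 =
        fold (relax (graph I) n L) (schedule n L T) (initial_table n L (source I) (budget I))
          (address n L T (source I) (L - 1)))"
      by (rule wp_table_code[where k = "quota I"])
        (use False in \<open>simp_all add: L_def n_def T_def initial_state_def\<close>)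
    have L: "2 * (quota I - 1) = L - 1" "0 < L" using False by (simp_all add: L_def)
    have yes: "ccto_yes I \<longleftrightarrow> 
        fold (relax (graph I) n L) (schedule n L T) (initial_table n L (source I) (budget I))
          (address n L T (source I) (L - 1)) \<noteq> 0"
      unfolding yes_iff G(3) L(1) by (rule final_table_pos_iff[OF G(2,3) s L(2), symmetric])
    have "?k + 1 \<le> 100 * (n * T * quota I) ^ 2"
      using dp_time_le[of n T "quota I" "source I" L] s T False by (simp add: L_def)
    then have "wp (graph I) table_code (?r, \<lambda>_. 0) (?bound - 1) (\<lambda>\<tau>. accepting \<tau> \<longleftrightarrow> ccto_yes I)"
      by (intro wp_mono[OF code]) (auto simp: accepting_def yes)
    moreover have "initial_state I = (?r, \<lambda>_. 0)" "?r 8 = 0" "?r 4 = quota I"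
      by (simp_all add: initial_state_def)
    ultimately show ?thesis using False by (simp add: ccto_code_def wp_If)
  qed
  then show "\<exists>k \<tau>. exec (graph I) ccto_code (initial_state I) k \<tau> \<and>
      k \<le> 100 * max 1 ((card (verts (graph I)) * horizon (graph I) * quota I)\<^sup>2) \<and>
      (accepting \<tau> \<longleftrightarrow> ccto_yes I)"
    by (auto simp: wp_def n_def T_def)
qed

end
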